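(* Let $c_0,c_1,c_2\in\mathbb{R}$. The inequalities $$T_n(x)\geq c_0+c_1x+c_2x^2>0$$ hold for all integers $n\geq 1$ and all real numbers $x\in(0,\pi)$ if and only if $$c_0=\pi^2c_2,\qquad c_1=-2\pi c_2,\qquad 0<c_2\leq\alpha,$$ where $$\alpha=\min_{0\leq t<\pi}\frac{T_6(t)}{(t-\pi)^2}=0.12290\ldots .$$
   Context: For integers $k\geq 0$ set $b_{2k}=b_{2k+1}=\frac{1}{4^k}\binom{2k}{k}$, and for $n\geq 1$ let $T_n(x)=\sum_{k=0}^n b_k\cos(kx)$. The notation $0.12290\ldots$ means that the decimal expansion begins with these digits, i.e. $0.12290\leq\alpha<0.12291$. *)

theory Defs
  imports "HOL-Analysis.Analysis"
begin

definition b :: "nat \<Rightarrow> real" where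
  "b j = real ((2 * (j div 2)) choose (j div 2)) / 4 ^ (j div 2)"

definition T :: "nat \<Rightarrow> real \<Rightarrow> real" where
  "T n x = (\<Sum>k=0..n. b k * cos (real k * x))"

definition is_minimum_on :: "(real \<Rightarrow> real) \<Rightarrow> real set \<Rightarrow> real \<Rightarrow> bool" where
  "is_minimum_on f S m \<longleftrightarrow> m \<in> f ` S \<and> (\<forall>t\<in>S. m \<le> f t)"

lemma b_even: "b (2 * k) = real ((2 * k) choose k) / 4 ^ k"
  and b_odd: "b (2 * k + 1) = real ((2 * k) choose k) / 4 ^ k"
  by (simp_all add: b_def)

lemma is_minimum_on_unique:
  "is_minimum_on f S m \<Longrightarrow> is_minimum_on f S m' \<Longrightarrow> m = m'"
  by (force simp: is_minimum_on_def)

end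

(* Since T 1 x = 1 + cos x has a double zero at pi, a quadratic squeezed between 0 and T 1 near pi
   is c2 (pi - x)^2; the content is that T n x >= alpha (pi - x)^2 for all n, where alpha is the
   optimal constant for n = 6 and every other n allows 0.12291 > alpha.

   T n x converges to the real part of (1 + z) / sqrt (1 - z^2) at z = exp (i x), which is
   sqrt (sin x) / (2 sin (x / 2)).  For n >= 20, summation by parts bounds T n x from below by
   this limit minus an explicit tail, and Wallis' product bounds
   b (n + 1) <= sqrt (2 / (pi (n + 1/2))); the remaining inequalities involve x only, or n x
   close to an endpoint of the interval.

   For n <= 19, T n x is a polynomial in c = cos x, and (pi - x)^2 = (pi - arccos c)^2 is convex
   in c for c >= 0, hence below its chords.  This leaves polynomial inequalities on short intervals
   with enough room for all n except n = 6 and c in [11/16, 3/4]; there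
   T 6 x - 0.1229 (pi - x)^2 is convex and lies above its tangent at the near-minimum. *)
theory Submission
  imports Defs "HOL-Real_Asymp.Real_Asymp"
begin

section \<open>Central binomial coefficients\<close>

text \<open>The obstacle is that \<open>T n\<close> does not converge uniformly at either end of the
  interval. After multiplication by 2 sin (x/2), near x = 0 the limit sqrt (sin x) and the tail are
  both of order sqrt x times a function of the phase (n + 1/2) x alone, and near pi the same holds
  with u = pi - x in place of x. So no threshold for n makes the tail negligible there. Small phases
  are settled by the signs of the terms added to \<open>T 1\<close>, larger phases by the tail
  estimates. Near 0 one summation by parts is too weak, since it can lose 2 b (n + 1); a second one
  brings the loss down to little more than b (n + 1). Near pi the first one is enough. The exact
  alpha is never computed. Everything away from the minimum is proved with the rational 0.12291,
  which appears as 12291/10 on the scale 10^4 and as 24582/100000 after multiplication by 2 sin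
  (x/2). The case n = 6 needs only 0.1229 near the minimum, and alpha itself comes from
  compactness.\<close>

definition cb :: "nat \<Rightarrow> real" where
  "cb k = real ((2 * k) choose k) / 4 ^ k"

lemma b_double: "b (2 * k) = cb k" and b_Suc_double: "b (Suc (2 * k)) = cb k"
  using b_even[of k] b_odd[of k] by (simp_all add: cb_def)

lemma cb_0 [simp]: "cb 0 = 1"
  by (simp add: cb_def)

lemma cb_Suc: "cb (Suc k) = cb k * (2 * real k + 1) / (2 * real k + 2)"
proof -
  have e: "real ((2 * j) choose j) = fact (2 * j) / (fact j * fact j)" for j
    using binomial_fact[of j "2 * j", where 'a = real] by simp
  have f: "fact (2 * Suc k) = (2 * real k + 2) * (2 * real k + 1) * fact (2 * k)"
    by (simp add: algebra_simps)
  show ?thesis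
    unfolding cb_def e f by (simp add: divide_simps) (simp add: algebra_simps)
qed

lemma cb_pos: "cb k > 0"
  by (simp add: cb_def)

lemma cb_diff: "cb k - cb (Suc k) = cb k / (2 * real k + 2)"
  by (simp add: cb_Suc field_simps)

lemma cb_Suc_le: "cb (Suc k) \<le> cb k"
  using cb_diff[of k] cb_pos[of k] by (smt (verit) divide_nonneg_nonneg of_nat_0_le_iff)

lemma cb_diff_le: "cb (Suc k) - cb (Suc (Suc k)) \<le> cb k - cb (Suc k)"
  unfolding cb_diff by (rule frac_le) (use cb_pos[of k] cb_Suc_le[of k] in auto)

text \<open>\<open>cb m\<close> is the product of the (2k-1)/(2k), so its square times 2m+1 is the
  reciprocal of the m-th partial Wallis product. This is how pi enters the coefficient
  bounds.\<close>

lemma cb_wallis: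
  "(cb m)\<^sup>2 * (2 * real m + 1) * (\<Prod>k=1..m. (4 * real k ^ 2) / (4 * real k ^ 2 - 1)) = 1"
proof (induction m)
  case (Suc m)
  define P where "P = (\<Prod>k=1..m. (4 * real k ^ 2) / (4 * real k ^ 2 - 1))"
  have nz: "4 * real (Suc m) ^ 2 - 1 = (2 * real m + 1) * (2 * real m + 3)"
    by (simp add: power2_eq_square algebra_simps)
  have "(cb (Suc m))\<^sup>2 * (2 * real (Suc m) + 1) * (P * ((4 * real (Suc m) ^ 2) / (4 * real (Suc m) ^
      2 - 1)))
      = (cb m)\<^sup>2 * (2 * real m + 1) * P"
    unfolding nz cb_Suc power_divide power_mult_distrib
    by (simp add: divide_simps add_eq_0_iff) (simp add: algebra_simps power2_eq_square)
  also have "\<dots> = 1"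
    using Suc by (simp add: P_def)
  finally have "(cb (Suc m))\<^sup>2 * (2 * real (Suc m) + 1) * (P * ((4 * real (Suc m) ^ 2) / (4 * real
      (Suc m) ^ 2 - 1))) = 1" .
  moreover have "(\<Prod>k=1..Suc m. (4 * real k ^ 2) / (4 * real k ^ 2 - 1))
      = P * ((4 * real (Suc m) ^ 2) / (4 * real (Suc m) ^ 2 - 1))"
    unfolding P_def by (subst prod.nat_ivl_Suc') (simp, simp only: mult.commute)
  ultimately show ?case by (simp only:)
qed simp

lemma cb_square_limit: "(\<lambda>m. (cb m)\<^sup>2 * (real m + 1 / 4)) \<longlonglongrightarrow> 1 / pi"
proof -
  define W where "W = (\<lambda>m::nat. \<Prod>k=1..m. (4 * real k ^ 2) / (4 * real k ^ 2 - 1))"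
  have W: "W \<longlonglongrightarrow> pi / 2"
    using wallis by (simp add: W_def)
  have l: "(\<lambda>m. (real m + 1 / 4) / (2 * real m + 1)) \<longlonglongrightarrow> 1 / 2"
    by real_asymp
  have "(\<lambda>m. inverse (W m) * ((real m + 1 / 4) / (2 * real m + 1))) \<longlonglongrightarrow> inverse (pi / 2) * (1 / 2)"
    by (intro tendsto_mult tendsto_inverse W l) simp
  moreover have "inverse (W m) * ((real m + 1 / 4) / (2 * real m + 1)) = (cb m)\<^sup>2 * (real m + 1 /
      4)" for m
  proof -
    have e: "(cb m)\<^sup>2 * (2 * real m + 1) * W m = 1"
      using cb_wallis[of m] by (simp add: W_def)
    have i: "inverse (W m) = (cb m)\<^sup>2 * (2 * real m + 1)"
      using inverse_unique[of "W m" "(cb m)\<^sup>2 * (2 * real m + 1)"] e by (simp only: mult.commute)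
    have "2 * real m + 1 \<noteq> 0" by linarith
    then show ?thesis unfolding i by (simp add: field_simps)
  qed
  moreover have "inverse (pi / 2) * (1 / 2) = 1 / pi"
    by (simp add: field_simps)
  ultimately show ?thesis by (simp only:)
qed

text \<open>The shift by \<open>1/4\<close> makes \<open>cb m ^ 2 * (m + 1/4)\<close> increase to Wallis' limit.\<close>

lemma cb_square_le: "(cb m)\<^sup>2 * (real m + 1 / 4) \<le> 1 / pi"
proof -
  have "incseq (\<lambda>m. (cb m)\<^sup>2 * (real m + 1 / 4))"
  proof (rule incseq_SucI)
    fix m
    have "(real m + 1 / 4) * (2 * real m + 2)\<^sup>2 \<le> (2 * real m + 1)\<^sup>2 * (real (Suc m) + 1 / 4)"
      by (simp add: power2_eq_square algebra_simps)
    then have "(cb m)\<^sup>2 * (real m + 1 / 4) * (2 * real m + 2)\<^sup>2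
        \<le> (cb m)\<^sup>2 * ((2 * real m + 1)\<^sup>2 * (real (Suc m) + 1 / 4))"
      by (simp add: mult_left_mono mult.assoc)
    then show "(cb m)\<^sup>2 * (real m + 1 / 4) \<le> (cb (Suc m))\<^sup>2 * (real (Suc m) + 1 / 4)"
      unfolding cb_Suc power_divide power_mult_distrib
      by (simp add: divide_simps mult_ac)
  qed
  from incseq_le[OF this cb_square_limit] show ?thesis .
qed

lemma cb_le: "cb m \<le> sqrt (2 / (pi * (2 * real m + 1 / 2)))"
proof (rule real_le_rsqrt)
  have "(cb m)\<^sup>2 * (2 * real m + 1 / 2) * pi \<le> 2"
    using cb_square_le[of m] by (simp add: field_simps)
  then show "(cb m)\<^sup>2 \<le> 2 / (pi * (2 * real m + 1 / 2))"
    by (subst pos_le_divide_eq) (auto simp: mult_ac intro: add_nonneg_pos)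
qed

text \<open>Stated in \<open>n\<close> so that one formula serves both parities: for even
  \<open>n\<close> it is \<open>cb_le\<close> itself, for odd \<open>n\<close> the index of
  \<open>cb\<close> is one larger and there is slack.\<close>

lemma b_Suc_le: "b (Suc n) \<le> sqrt (2 / (pi * (real n + 1 / 2)))"
proof (cases "even n")
  case True
  then obtain m where "n = 2 * m" by blast
  then show ?thesis using cb_le[of m] by (simp add: b_Suc_double)
next
  case False
  then obtain m where m: "n = 2 * m + 1" using oddE by blast
  have "b (Suc n) = cb (Suc m)" using b_double[of "Suc m"] m by simp
  also have "\<dots> \<le> sqrt (2 / (pi * (2 * real (Suc m) + 1 / 2)))" by (rule cb_le)
  also have "\<dots> \<le> sqrt (2 / (pi * (real n + 1 / 2)))"
    by (intro real_sqrt_le_mono divide_left_mono mult_left_mono) (auto simp: m intro!: mult_pos_pos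
        add_nonneg_pos)
  finally show ?thesis .
qed

lemma b_nonneg: "b n \<ge> 0"
  by (simp add: b_def)

lemma b_decseq: "b (Suc n) \<le> b n"
proof (cases "even n")
  case True
  then obtain m where "n = 2 * m" by blast
  then show ?thesis by (simp add: b_Suc_double b_double)
next
  case False
  then obtain m where m: "n = 2 * m + 1" using oddE by blast
  then show ?thesis using b_double[of "Suc m"] b_Suc_double[of m] cb_Suc_le[of m] by simp
qed

lemma T_Suc: "T (Suc n) x = T n x + b (Suc n) * cos (real (Suc n) * x)"
  by (simp add: T_def)

lemma cb_tendsto_0: "cb \<longlonglongrightarrow> 0"
proof (rule tendsto_sandwich[OF _ _ tendsto_const])
  show "(\<lambda>m. sqrt (2 / (pi * (2 * real m + 1 / 2)))) \<longlonglongrightarrow> 0"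
    by real_asymp
qed (use cb_le cb_pos in \<open>auto intro!: always_eventually simp: less_imp_le\<close>)

section \<open>The limit of the cosine sums\<close>

text \<open>Up to sign these are the binomial coefficients of -1/2, which makes (1 - w)^(-1/2) the
  generating function of \<open>cb\<close>.\<close>

lemma gbinomial_minus_half: "((- 1 / 2 :: complex) gchoose k) = (- 1) ^ k * of_real (cb k)"
proof (induction k)
  case (Suc k)
  have "of_nat (Suc k) * ((- 1 / 2 :: complex) gchoose Suc k)
      = (- 1 / 2 - of_nat k) * ((- 1 / 2) gchoose k)"
    using gbinomial_mult_1[of "- 1 / 2 :: complex" k] by (simp add: algebra_simps)
  then have "of_nat (Suc k) * ((- 1 / 2 :: complex) gchoose Suc k)
      = (- 1 / 2 - of_nat k) * ((- 1) ^ k * of_real (cb k))"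
    unfolding Suc .
  also have "\<dots> = of_nat (Suc k) * ((- 1) ^ Suc k * (of_real (cb k) * (2 * of_nat k + 1) / (2 *
      of_nat (Suc k))))"
    by (simp add: field_simps del: of_nat_Suc)
  also have "of_real (cb k) * (2 * of_nat k + 1) / (2 * of_nat (Suc k)) = (of_real (cb (Suc k)) ::
      complex)"
    unfolding cb_Suc by simp
  finally show ?case
    by (simp only: mult_cancel_left of_nat_eq_0_iff) simp
qed simp

lemma cb_series:
  fixes w :: complex
  assumes "norm w < 1"
  shows "(\<lambda>k. of_real (cb k) * w ^ k) sums ((1 - w) powr (- 1 / 2))"
proof -
  have "(\<lambda>k. ((- 1 / 2 :: complex) gchoose k) * (- w) ^ k) sums ((1 + - w) powr (- 1 / 2))"
    by (rule gen_binomial_complex) (use assms in simp)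
  moreover have "((- 1 / 2 :: complex) gchoose k) * (- w) ^ k = of_real (cb k) * w ^ k" for k
    unfolding gbinomial_minus_half power_minus[of w] by (simp flip: power_mult_distrib add: mult_ac)
  ultimately show ?thesis by simp
qed

section \<open>Abel summation for the binomial series up to the unit circle\<close>

definition cbsum :: "nat \<Rightarrow> complex \<Rightarrow> complex" where
  "cbsum m w = (\<Sum>k<m. of_real (cb k) * w ^ k)"

text \<open>Abel summation: the factor \<open>1 - w\<close> turns the sum into one over the
  decrements of \<open>cb\<close>, which telescope. The bound involves neither \<open>K\<close> nor
  \<open>w\<close>, so it survives both K to infinity and w tending to the circle.\<close>

lemma cbsum_diff_bound:
  assumes w: "norm w \<le> 1" and "m \<le> K"
  shows "norm ((1 - w) * (cbsum K w - cbsum m w)) \<le> 2 * cb m"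
proof -
  \<comment> \<open>The boundary term \<open>cb K * w ^ K\<close> is carried along so that each
    induction step costs at most the decrement \<open>cb K - cb (Suc K)\<close>.\<close>
  have "norm ((1 - w) * (cbsum K w - cbsum m w) + of_real (cb K) * w ^ K) \<le> 2 * cb m - cb K"
    using \<open>m \<le> K\<close>
  proof (induction K rule: dec_induct)
    case base
    have "norm (w ^ m) \<le> 1"
      using w by (simp add: norm_power power_le_one)
    then show ?case
      using cb_pos[of m] by (simp add: norm_mult mult_left_le)
  next
    case (step K)
    have e: "(1 - w) * (cbsum (Suc K) w - cbsum m w) + of_real (cb (Suc K)) * w ^ Suc K
        = ((1 - w) * (cbsum K w - cbsum m w) + of_real (cb K) * w ^ K)
          - of_real (cb K - cb (Suc K)) * w ^ Suc K"
      by (simp add: cbsum_def algebra_simps)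
    have "norm (w ^ Suc K) \<le> 1"
      using w by (metis norm_ge_zero norm_power power_le_one)
    then have "norm (of_real (cb K - cb (Suc K)) * w ^ Suc K) \<le> cb K - cb (Suc K)"
      using cb_Suc_le[of K] unfolding norm_mult norm_of_real by (simp add: mult_left_le)
    then show ?case
      unfolding e using step.IH norm_triangle_ineq4 by (smt (verit))
  qed
  moreover have "norm (of_real (cb K) * w ^ K) \<le> cb K"
    using w cb_pos[of K] by (simp add: norm_mult norm_power mult_left_le power_le_one)
  ultimately show ?thesis
    using norm_triangle_ineq4[of "(1 - w) * (cbsum K w - cbsum m w) + of_real (cb K) * w ^ K"
        "of_real (cb K) * w ^ K"] by simp
qed

lemma cbsum_error_open:
  assumes "norm w < 1"
  shows "norm ((1 - w) * ((1 - w) powr (- 1 / 2) - cbsum m w)) \<le> 2 * cb m"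
proof (rule Lim_norm_ubound)
  show "(\<lambda>K. (1 - w) * (cbsum K w - cbsum m w)) \<longlonglongrightarrow> (1 - w) * ((1 - w) powr (- 1 / 2) - cbsum m w)"
    using cb_series[OF assms] unfolding sums_def cbsum_def[symmetric] by (intro tendsto_intros)
  show "\<forall>\<^sub>F K in sequentially. norm ((1 - w) * (cbsum K w - cbsum m w)) \<le> 2 * cb m"
    using eventually_ge_at_top[of m] by eventually_elim (use assms
        in \<open>auto intro: cbsum_diff_bound\<close>)
qed simp

text \<open>The error bound of the partial sums inside the disc is uniform, so it survives the radial
  limit; this replaces Abel's limit theorem.\<close>

lemma cbsum_error_boundary:
  assumes w: "norm w \<le> 1" and re: "Re w < 1"
  shows "norm ((1 - w) * ((1 - w) powr (- 1 / 2) - cbsum m w)) \<le> 2 * cb m"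
proof (rule Lim_norm_ubound)
  let ?f = "\<lambda>t. (1 - of_real t * w) * ((1 - of_real t * w) powr (- 1 / 2) - cbsum m (of_real t *
      w))"
  \<comment> \<open>The condition on \<open>Re w\<close> keeps \<open>1 - w\<close> off the branch
    cut, so the power is continuous at the end of the radius.\<close>
  have nz: "1 - w \<notin> \<real>\<^sub>\<le>\<^sub>0"
    using re by (auto simp: complex_nonpos_Reals_iff)
  have t: "((\<lambda>t::real. of_real t * w) \<longlongrightarrow> of_real 1 * w) (at_left 1)"
    by (intro tendsto_intros)
  show "(?f \<longlongrightarrow> (1 - w) * ((1 - w) powr (- 1 / 2) - cbsum m w)) (at_left (1::real))"
    unfolding cbsum_def
    by (intro tendsto_mult tendsto_diff tendsto_const tendsto_powr_complex tendsto_sum tendsto_power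
        t[simplified]) (use nz in auto)
  have "\<forall>\<^sub>F t in at_left (1::real). t > 0"
    using eventually_at_left_real[of 0 1] by (auto elim: eventually_mono)
  moreover have "\<forall>\<^sub>F t in at_left (1::real). t < 1"
    by (simp add: eventually_at_filter)
  ultimately show "\<forall>\<^sub>F t in at_left (1::real). norm (?f t) \<le> 2 * cb m"
  proof eventually_elim
    case (elim t)
    have "norm (of_real t * w) < 1"
      using elim w by (simp add: norm_mult) (smt (verit) mult_less_cancel_right1 mult_left_le
          norm_ge_zero)
    then show ?case by (rule cbsum_error_open)
  qed
qed simp

lemma cbsum_tendsto:
  assumes w: "norm w \<le> 1" and re: "Re w < 1"
  shows "(\<lambda>m. cbsum m w) \<longlonglongrightarrow> (1 - w) powr (- 1 / 2)"
proof -
  have nz: "norm (1 - w) > 0"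
    using re by auto
  have "(\<lambda>m. cbsum m w - (1 - w) powr (- 1 / 2)) \<longlonglongrightarrow> 0"
  proof (rule Lim_null_comparison)
    have "norm (1 - w) * norm (cbsum m w - (1 - w) powr (- 1 / 2)) \<le> 2 * cb m" for m
      using cbsum_error_boundary[OF w re, of m] by (simp only: norm_mult norm_minus_commute)
    then have "norm (cbsum m w - (1 - w) powr (- 1 / 2)) \<le> 2 * cb m / norm (1 - w)" for m
      by (simp only: pos_le_divide_eq[OF nz] mult.commute)
    then show "\<forall>\<^sub>F m in sequentially. norm (cbsum m w - (1 - w) powr (- 1 / 2))
        \<le> 2 * cb m / norm (1 - w)"
      by simp
    show "(\<lambda>m. 2 * cb m / norm (1 - w)) \<longlonglongrightarrow> 0"
      using tendsto_divide[OF tendsto_mult[OF tendsto_const[of 2] cb_tendsto_0] tendsto_const[of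
          "norm (1 - w)"]] nz
      by simp
  qed
  then show ?thesis by (simp add: LIM_zero_iff)
qed

text \<open>Stopping at an odd index leaves complete pairs 2k, 2k+1 with the common coefficient
  \<open>cb k\<close>; each pair contributes the factor \<open>1 + cis x\<close>.\<close>

lemma T_odd_eq: "T (Suc (2 * m)) x = Re ((1 + cis x) * cbsum (Suc m) (cis (2 * x)))"
proof (induction m)
  case 0
  show ?case using b_double[of 0] b_Suc_double[of 0] by (simp add: T_def cbsum_def)
next
  case (Suc m)
  define \<theta> where "\<theta> = real (2 * Suc m) * x"
  have p: "cis (2 * x) ^ Suc m = cis \<theta>"
    unfolding Complex.DeMoivre \<theta>_def by (simp add: mult_ac)
  have q: "real (Suc (2 * Suc m)) * x = \<theta> + x"
    by (simp add: \<theta>_def algebra_simps)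
  have "Re ((1 + cis x) * (of_real (cb (Suc m)) * cis (2 * x) ^ Suc m))
      = cb (Suc m) * cos \<theta> + cb (Suc m) * cos (real (Suc (2 * Suc m)) * x)"
    unfolding p q by (simp add: cos_add algebra_simps)
  moreover have "T (Suc (2 * Suc m)) x = T (Suc (2 * m)) x
      + cb (Suc m) * cos \<theta> + cb (Suc m) * cos (real (Suc (2 * Suc m)) * x)"
    using T_Suc[of "2 * Suc m" x] T_Suc[of "Suc (2 * m)" x] b_double[of "Suc m"] b_Suc_double[of
        "Suc m"]
    by (simp add: \<theta>_def)
  moreover have "cbsum (Suc (Suc m)) (cis (2 * x)) = cbsum (Suc m) (cis (2 * x))
      + of_real (cb (Suc m)) * cis (2 * x) ^ Suc m"
    by (simp add: cbsum_def)
  ultimately show ?case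
    using Suc.IH by (simp only: distrib_left plus_complex.sel)
qed

text \<open>Written as an exponential whose imaginary part lies strictly between -pi/2 and pi/2, so
  that the principal logarithm can be read off.\<close>

lemma one_minus_cis_double:
  assumes "0 < x" "x < pi"
  shows "1 - cis (2 * x) = exp (of_real (ln (2 * sin x)) + \<i> * of_real (x - pi / 2))"
proof -
  have "sin x > 0" using assms by (rule sin_gt_zero)
  then have "exp (of_real (ln (2 * sin x)) + \<i> * of_real (x - pi / 2)) = of_real (2 * sin x) * cis
      (x - pi / 2)"
    by (simp add: exp_add cis_conv_exp exp_of_real)
  moreover have "1 - cis (2 * x) = of_real (2 * sin x) * cis (x - pi / 2)"
    by (simp add: complex_eq_iff cos_diff sin_diff cos_double_sin sin_double power2_eq_square)
  ultimately show ?thesis by simp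
qed

text \<open>The phase of \<open>1 + cis x\<close> is x/2 and that of the power is pi/4 - x/2. The
  product has constant phase pi/4, so its real part is its modulus times sqrt 2 / 2.\<close>

lemma limit_value:
  assumes "0 < x" "x < pi"
  shows "Re ((1 + cis x) * (1 - cis (2 * x)) powr (- 1 / 2)) = sqrt (sin x) / (2 * sin (x / 2))"
proof -
  have s: "sin x > 0" using assms by (rule sin_gt_zero)
  have s2: "sin (x / 2) > 0" and c2: "cos (x / 2) > 0"
    using assms by (auto intro!: sin_gt_zero cos_gt_zero)
  have sx: "sin x = 2 * sin (x / 2) * cos (x / 2)"
    using sin_double[of "x / 2"] by simp
  have "Ln (1 - cis (2 * x)) = of_real (ln (2 * sin x)) + \<i> * of_real (x - pi / 2)"
    unfolding one_minus_cis_double[OF assms] by (rule Ln_exp) (use assms in auto)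
  moreover have "1 - cis (2 * x) \<noteq> 0"
    unfolding one_minus_cis_double[OF assms] by simp
  ultimately have "(1 - cis (2 * x)) powr (- 1 / 2)
      = exp (- 1 / 2 * (of_real (ln (2 * sin x)) + \<i> * of_real (x - pi / 2)))"
    by (simp only: powr_def if_False)
  also have "- 1 / 2 * (of_real (ln (2 * sin x)) + \<i> * of_real (x - pi / 2))
      = of_real (- (ln (2 * sin x) / 2)) + \<i> * of_real (pi / 4 - x / 2)"
    by (simp add: field_simps)
  also have "exp (of_real (- (ln (2 * sin x) / 2)) + \<i> * of_real (pi / 4 - x / 2))
      = of_real (exp (- (ln (2 * sin x) / 2))) * cis (pi / 4 - x / 2)"
    by (simp only: exp_add cis_conv_exp exp_of_real)
  also have "exp (- (ln (2 * sin x) / 2)) = 1 / sqrt (2 * sin x)"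
    using s by (simp add: exp_minus ln_sqrt[symmetric] inverse_eq_divide)
  finally have p: "(1 - cis (2 * x)) powr (- 1 / 2) = of_real (1 / sqrt (2 * sin x)) * cis (pi / 4
      - x / 2)" .
  have "1 + cis x = of_real (2 * cos (x / 2)) * cis (x / 2)"
    using cos_double_cos[of "x / 2"] sin_double[of "x / 2"]
    by (simp add: complex_eq_iff power2_eq_square)
  then have "(1 + cis x) * (1 - cis (2 * x)) powr (- 1 / 2)
      = of_real (2 * cos (x / 2) / sqrt (2 * sin x)) * (cis (x / 2) * cis (pi / 4 - x / 2))"
    unfolding p by simp
  also have "cis (x / 2) * cis (pi / 4 - x / 2) = cis (pi / 4)"
    by (simp add: cis_mult)
  finally have "Re ((1 + cis x) * (1 - cis (2 * x)) powr (- 1 / 2))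
      = 2 * cos (x / 2) / sqrt (2 * sin x) * (sqrt 2 / 2)"
    by (simp add: cos_45)
  also have "\<dots> = cos (x / 2) / sqrt (sin x)"
    by (simp add: real_sqrt_mult)
  also have "\<dots> = sqrt (sin x) / (2 * sin (x / 2))"
  proof -
    have "cos (x / 2) * (2 * sin (x / 2)) = sqrt (sin x) * sqrt (sin x)"
      using s sx by simp
    then show ?thesis
      using s s2 by (simp add: frac_eq_eq)
  qed
  finally show ?thesis .
qed

text \<open>Odd indices are enough: below, monotone corrected sums are compared with their limit
  along this subsequence.\<close>

lemma T_odd_tendsto:
  assumes "0 < x" "x < pi"
  shows "(\<lambda>m. 2 * sin (x / 2) * T (Suc (2 * m)) x) \<longlonglongrightarrow> sqrt (sin x)"
proof -
  have "sin x > 0" using assms by (rule sin_gt_zero)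
  then have re: "Re (cis (2 * x)) < 1"
    by (simp add: cos_double_sin)
  have "(\<lambda>m. cbsum (Suc m) (cis (2 * x))) \<longlonglongrightarrow> (1 - cis (2 * x)) powr (- 1 / 2)"
    using LIMSEQ_Suc[OF cbsum_tendsto[OF _ re]] by simp
  then have "(\<lambda>m. Re ((1 + cis x) * cbsum (Suc m) (cis (2 * x))))
      \<longlonglongrightarrow> Re ((1 + cis x) * (1 - cis (2 * x)) powr (- 1 / 2))"
    by (intro tendsto_intros)
  then have "(\<lambda>m. T (Suc (2 * m)) x) \<longlonglongrightarrow> sqrt (sin x) / (2 * sin (x / 2))"
    unfolding T_odd_eq limit_value[OF assms] .
  then have "(\<lambda>m. 2 * sin (x / 2) * T (Suc (2 * m)) x)
      \<longlonglongrightarrow> 2 * sin (x / 2) * (sqrt (sin x) / (2 * sin (x / 2)))"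
    by (intro tendsto_intros)
  moreover have "sin (x / 2) > 0" using assms by (auto intro!: sin_gt_zero)
  ultimately show ?thesis by simp
qed

section \<open>Tail estimates\<close>

text \<open>Both tail estimates are summations by parts, phrased as the monotonicity of a corrected
  partial sum whose correction tends to \<open>0\<close>.\<close>

lemma T_lower_first_order:
  assumes x: "0 < x" "x < pi"
  shows "2 * sin (x / 2) * T n x \<ge> sqrt (sin x) - b (Suc n) * (1 - sin ((real n + 1 / 2) * x))"
proof -
  define S where "S = (\<lambda>n::nat. sin ((real n + 1 / 2) * x))"
  \<comment> \<open>The increments of \<open>S\<close> are the added cosines times 2 sin (x/2).
    Correcting with \<open>1 - S\<close> rather than \<open>- S\<close> gives each decrement of
    \<open>b\<close> a nonnegative weight, whence monotonicity.\<close>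
  define \<Psi> where "\<Psi> = (\<lambda>n. 2 * sin (x / 2) * T n x + b (Suc n) * (1 - S n))"
  have dec: "decseq \<Psi>"
  proof (rule decseq_SucI)
    fix n
    have "S (Suc n) - S n = 2 * sin (x / 2) * cos (real (Suc n) * x)"
      unfolding S_def sin_diff_sin by (simp add: algebra_simps add_divide_distrib)
    then have "\<Psi> n - \<Psi> (Suc n) = (b (Suc n) - b (Suc (Suc n))) * (1 - S (Suc n))"
      unfolding \<Psi>_def T_Suc by (simp add: algebra_simps)
    moreover have "\<dots> \<ge> 0"
      using b_decseq[of "Suc n"] by (simp add: S_def)
    ultimately show "\<Psi> (Suc n) \<le> \<Psi> n" by linarith
  qed
  have c: "(\<lambda>m. b (Suc (Suc (2 * m))) * (1 - S (Suc (2 * m)))) \<longlonglongrightarrow> 0"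
  proof (rule Lim_null_comparison)
    have "(\<lambda>m. 2 * cb (Suc m)) \<longlonglongrightarrow> 2 * 0"
      by (intro tendsto_intros LIMSEQ_Suc cb_tendsto_0)
    then show "(\<lambda>m. 2 * cb (Suc m)) \<longlonglongrightarrow> 0" by simp
    have "norm (b (Suc (Suc (2 * m))) * (1 - S (Suc (2 * m)))) \<le> 2 * cb (Suc m)" for m
    proof -
      have "\<bar>1 - S (Suc (2 * m))\<bar> \<le> 2"
        unfolding S_def using sin_ge_minus_one sin_le_one by (smt (verit))
      then show ?thesis
        using b_double[of "Suc m"] cb_pos[of "Suc m"] by (simp add: abs_mult)
    qed
    then show "\<forall>\<^sub>F m in sequentially. norm (b (Suc (Suc (2 * m))) * (1 - S (Suc (2 * m))))
        \<le> 2 * cb (Suc m)"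
      by simp
  qed
  have "(\<lambda>m. \<Psi> (Suc (2 * m))) \<longlonglongrightarrow> sqrt (sin x)"
    unfolding \<Psi>_def using tendsto_add[OF T_odd_tendsto[OF x] c] by simp
  moreover have "\<forall>\<^sub>F m in sequentially. \<Psi> (Suc (2 * m)) \<le> \<Psi> n"
    using eventually_ge_at_top[of n] by eventually_elim (auto intro: decseqD[OF dec])
  ultimately have "sqrt (sin x) \<le> \<Psi> n"
    by (rule tendsto_upperbound) simp
  then show ?thesis by (simp add: \<Psi>_def S_def)
qed

text \<open>Pairing equal coefficients makes the increment \<open>2 * sin x * C\<close>, a
  difference of consecutive \<open>S\<close>; the differences of \<open>S\<close> against
  \<open>D\<close> are then summed by parts once more, since \<open>2 * sin x * S\<close> is a
  difference of consecutive \<open>C\<close>. The weight \<open>1 + C\<close> is nonnegative and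
  \<open>D\<close> decreases (\<open>cb_diff_le\<close>). The price of the sign is now of order cb /
  (m sin x), and the main correction is an oscillating sine that can also help.\<close>

lemma T_odd_lower_second_order:
  assumes x: "0 < x" "x < pi"
  shows "2 * sin (x / 2) * T (Suc (2 * m)) x \<ge> sqrt (sin x) + cb (Suc m) *
    (sin ((2 * real m + 3 / 2) * x) - (1 + cos ((2 * real m + 5 / 2) * x)) / ((4 * real m + 8) *
        sin x))"
proof -
  have sx: "sin x > 0" using x by (rule sin_gt_zero)
  have sxs: "sin x = 2 * sin (x / 2) * cos (x / 2)"
    using sin_double[of "x / 2"] by simp
  define S where "S = (\<lambda>m::nat. sin ((2 * real m - 1 / 2) * x))"
  define C where "C = (\<lambda>m::nat. cos ((2 * real m + 1 / 2) * x))"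
  define D where "D = (\<lambda>m. cb m - cb (Suc m))"
  define \<Phi> where "\<Phi> = (\<lambda>m. 2 * sin (x / 2) * T (Suc (2 * m)) x - cb (Suc m) * S (Suc m)
    + (1 + C (Suc m)) * D (Suc m) / (2 * sin x))"
  have dec: "decseq \<Phi>"
  proof (rule decseq_SucI)
    fix m
    have S: "S (Suc (Suc m)) - S (Suc m) = 2 * sin x * C (Suc m)"
      unfolding S_def C_def sin_diff_sin by (simp add: algebra_simps add_divide_distrib)
    have C: "C (Suc m) - C (Suc (Suc m)) = 2 * sin x * S (Suc (Suc m))"
      unfolding S_def C_def cos_diff_cos by (simp add: algebra_simps add_divide_distrib)
    have "cos (real (2 * Suc m) * x) + cos (real (Suc (2 * Suc m)) * x) = 2 * cos (x / 2) * C (Suc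
        m)"
      unfolding C_def cos_plus_cos by (simp add: algebra_simps add_divide_distrib)
    moreover have "T (Suc (2 * Suc m)) x = T (Suc (2 * m)) x
        + cb (Suc m) * (cos (real (2 * Suc m) * x) + cos (real (Suc (2 * Suc m)) * x))"
      using T_Suc[of "2 * Suc m" x] T_Suc[of "Suc (2 * m)" x] b_double[of "Suc m"] b_Suc_double[of
          "Suc m"]
      by (simp add: algebra_simps)
    ultimately have "2 * sin (x / 2) * T (Suc (2 * Suc m)) x
        = 2 * sin (x / 2) * T (Suc (2 * m)) x + cb (Suc m) * (2 * sin x * C (Suc m))"
      by (simp add: sxs algebra_simps)
    also have "\<dots> = 2 * sin (x / 2) * T (Suc (2 * m)) x + cb (Suc m) * (S (Suc (Suc m)) - S (Suc m))"
      using S by simp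
    finally have "\<Phi> m - \<Phi> (Suc m) = (1 + C (Suc m)) * D (Suc m) / (2 * sin x)
        - (1 + C (Suc (Suc m))) * D (Suc (Suc m)) / (2 * sin x) - D (Suc m) * S (Suc (Suc m))"
      unfolding \<Phi>_def D_def by (simp add: algebra_simps)
    also have "\<dots> = ((1 + C (Suc m)) * D (Suc m) - (1 + C (Suc (Suc m))) * D (Suc (Suc m))
        - D (Suc m) * (C (Suc m) - C (Suc (Suc m)))) / (2 * sin x)"
      unfolding C using sx by (simp add: field_simps)
    also have "\<dots> = (1 + C (Suc (Suc m))) * (D (Suc m) - D (Suc (Suc m))) / (2 * sin x)"
      by (simp add: algebra_simps)
    also have "\<dots> \<ge> 0"
    proof -
      have "1 + C (Suc (Suc m)) \<ge> 0"
        unfolding C_def using cos_ge_minus_one by (smt (verit))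
      then show ?thesis
        using cb_diff_le[of "Suc m"] sx by (simp add: D_def)
    qed
    finally show "\<Phi> (Suc m) \<le> \<Phi> m" by linarith
  qed
  have c1: "(\<lambda>m. cb (Suc m) * S (Suc m)) \<longlonglongrightarrow> 0"
  proof (rule Lim_null_comparison)
    show "(\<lambda>m. cb (Suc m)) \<longlonglongrightarrow> 0"
      by (intro LIMSEQ_Suc cb_tendsto_0)
    show "\<forall>\<^sub>F m in sequentially. norm (cb (Suc m) * S (Suc m)) \<le> cb (Suc m)"
      using cb_pos by (auto simp: S_def abs_mult less_imp_le intro!: always_eventually mult_left_le)
  qed
  have c2: "(\<lambda>m. (1 + C (Suc m)) * D (Suc m) / (2 * sin x)) \<longlonglongrightarrow> 0"
  proof (rule Lim_null_comparison)
    have "(\<lambda>m. (cb (Suc m) - cb (Suc (Suc m))) / sin x) \<longlonglongrightarrow> (0 - 0) / sin x"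
      using sx by (intro tendsto_intros LIMSEQ_Suc cb_tendsto_0) auto
    then show "(\<lambda>m. D (Suc m) / sin x) \<longlonglongrightarrow> 0" by (simp add: D_def)
    have "norm ((1 + C (Suc m)) * D (Suc m) / (2 * sin x)) \<le> D (Suc m) / sin x" for m
    proof -
      have "0 \<le> 1 + C (Suc m)" "1 + C (Suc m) \<le> 2"
        unfolding C_def using cos_ge_minus_one cos_le_one by (smt (verit))+
      moreover have "D (Suc m) \<ge> 0"
        using cb_Suc_le by (simp add: D_def)
      ultimately have "(1 + C (Suc m)) * D (Suc m) \<le> 2 * D (Suc m)"
          "(1 + C (Suc m)) * D (Suc m) \<ge> 0"
        by (auto intro: mult_right_mono)
      then show ?thesis using sx by (simp add: field_simps)
    qed
    then show "\<forall>\<^sub>F m in sequentially. norm ((1 + C (Suc m)) * D (Suc m) / (2 * sin x))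
        \<le> D (Suc m) / sin x"
      by simp
  qed
  have "\<Phi> \<longlonglongrightarrow> sqrt (sin x)"
    unfolding \<Phi>_def using tendsto_add[OF tendsto_diff[OF T_odd_tendsto[OF x] c1] c2] by simp
  from decseq_ge[OF dec this, of m] have "sqrt (sin x) \<le> \<Phi> m" .
  moreover have "D (Suc m) = cb (Suc m) / (2 * real m + 4)"
    unfolding D_def cb_diff by (simp add: algebra_simps)
  then have "(1 + C (Suc m)) * D (Suc m) / (2 * sin x)
      = cb (Suc m) * ((1 + C (Suc m)) / ((2 * real m + 4) * (2 * sin x)))"
    by (simp add: mult.commute)
  moreover have "(2 * real m + 4) * (2 * sin x) = (4 * real m + 8) * sin x"
    by (simp add: algebra_simps)
  moreover have "S (Suc m) = sin ((2 * real m + 3 / 2) * x)"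
      "C (Suc m) = cos ((2 * real m + 5 / 2) * x)"
    by (simp_all add: S_def C_def algebra_simps)
  ultimately show ?thesis
    unfolding \<Phi>_def by (simp only: right_diff_distrib)
qed

text \<open>One more cosine on top of the odd case: times 2 sin (x/2) it is a difference of two
  sines and just replaces the sine in the bound by the next one.\<close>

lemma T_even_lower_second_order:
  assumes x: "0 < x" "x < pi" and m: "m > 0"
  shows "2 * sin (x / 2) * T (2 * m) x \<ge> sqrt (sin x) + cb m *
    (sin ((2 * real m + 1 / 2) * x) - (1 + cos ((2 * real m + 1 / 2) * x)) / ((4 * real m + 4) *
        sin x))"
proof -
  obtain j where j: "m = Suc j" using m gr0_implies_Suc by blast
  have "2 * sin (x / 2) * cos (real (2 * m) * x) = sin ((2 * real m + 1 / 2) * x) - sin ((2 * real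
      j + 3 / 2) * x)"
    unfolding sin_diff_sin j by (simp add: algebra_simps add_divide_distrib)
  moreover have "T (2 * m) x = T (Suc (2 * j)) x + cb m * cos (real (2 * m) * x)"
    using T_Suc[of "Suc (2 * j)" x] b_double[of m] by (simp add: j)
  then have "2 * sin (x / 2) * T (2 * m) x
      = 2 * sin (x / 2) * T (Suc (2 * j)) x + cb m * (2 * sin (x / 2) * cos (real (2 * m) * x))"
    by (simp add: algebra_simps)
  ultimately have "2 * sin (x / 2) * T (2 * m) x = 2 * sin (x / 2) * T (Suc (2 * j)) x
      + cb m * (sin ((2 * real m + 1 / 2) * x) - sin ((2 * real j + 3 / 2) * x))"
    by simp
  moreover have "2 * real j + 5 / 2 = 2 * real m + 1 / 2" "4 * real j + 8 = 4 * real m + 4"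
    by (simp_all add: j)
  then have "2 * sin (x / 2) * T (Suc (2 * j)) x \<ge> sqrt (sin x) + cb m * (sin ((2 * real j + 3 / 2)
      * x)
      - (1 + cos ((2 * real m + 1 / 2) * x)) / ((4 * real m + 4) * sin x))"
    using T_odd_lower_second_order[OF x, of j] by (simp only: j)
  ultimately show ?thesis
    by (simp only: right_diff_distrib)
qed

section \<open>Certified nonnegativity of integer polynomials\<close>

fun peval :: "int list \<Rightarrow> real \<Rightarrow> real" where
  "peval [] x = 0"
| "peval (a # p) x = of_int a + x * peval p x"

text \<open>Coefficients of \<open>c + (l + h x) * p\<close>: in the recursion \<open>c\<close>
  carries the contribution of the previous coefficient.\<close>

fun linmul :: "int \<Rightarrow> int \<Rightarrow> int \<Rightarrow> int list \<Rightarrow> int list" where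
  "linmul l h c [] = [c]"
| "linmul l h c (a # p) = (l * a + c) # linmul l h (h * a) p"

fun axpy :: "int \<Rightarrow> int list \<Rightarrow> int list \<Rightarrow> int list" where
  "axpy a [] q = q"
| "axpy a (c # p) [] = (a * c) # axpy a p []"
| "axpy a (c # p) (d # q) = (a * c + d) # axpy a p q"

lemma peval_linmul: "peval (linmul l h c p) x = of_int c + (of_int l + of_int h * x) * peval p x"
  by (induction l h c p rule: linmul.induct) (auto simp: algebra_simps)

lemma peval_axpy: "peval (axpy a p q) x = of_int a * peval p x + peval q x"
  by (induction a p q rule: axpy.induct) (auto simp: algebra_simps)

text \<open>The substitution \<open>x = (l + h s) / (d (1 + s))\<close> maps \<open>s \<ge> 0\<close> onto \<open>l/d \<le> x < h/d\<close>; after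
  clearing denominators, nonnegative coefficients in \<open>s\<close> certify nonnegativity of \<open>p\<close> there.
  The auxiliary functions make the simplifier normalise intermediate lists before they are
  duplicated.\<close>

fun moebius_cons :: "int \<Rightarrow> int \<Rightarrow> int \<Rightarrow> int list \<Rightarrow> int list \<Rightarrow> int list \<times> int list" where
  "moebius_cons l h a H W = (axpy a W (linmul l h 0 H), W)"

fun moebius_step :: "int \<Rightarrow> int \<Rightarrow> int \<Rightarrow> int \<Rightarrow> int list \<times> int list \<Rightarrow> int list \<times> int list" where
  "moebius_step d l h a (H, W) = moebius_cons l h a H (linmul d d 0 W)"

fun moebius :: "int \<Rightarrow> int \<Rightarrow> int \<Rightarrow> int list \<Rightarrow> int list \<times> int list" where
  "moebius d l h [] = ([], [1])"
| "moebius d l h (a # p) = moebius_step d l h a (moebius d l h p)"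

definition nonneg_on :: "int \<Rightarrow> int \<Rightarrow> int \<Rightarrow> int list \<Rightarrow> bool" where
  "nonneg_on d l h p \<longleftrightarrow> list_all (\<lambda>a. 0 \<le> a) (fst (moebius d l h p))"

text \<open>Horner's scheme in homogeneous form: the second component is the accumulated
  denominator. The exponent is the length of \<open>p\<close>, one more than the formal degree; the
  surplus factor is positive and does no harm.\<close>

lemma peval_moebius:
  assumes "d > 0" "s \<ge> 0"
  shows "peval (snd (moebius d l h p)) s = (of_int d * (1 + s)) ^ length p \<and>
    peval (fst (moebius d l h p)) s = (of_int d * (1 + s)) ^ length p *
      peval p ((of_int l + of_int h * s) / (of_int d * (1 + s)))"
proof (induction p)
  case (Cons a p)
  obtain H W where HW: "moebius d l h p = (H, W)" by fastforce
  define D where "D = of_int d * (1 + s)"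
  have D: "D \<noteq> 0" using assms by (auto simp: D_def)
  have W: "peval W s = D ^ length p"
    and H: "peval H s = D ^ length p * peval p ((of_int l + of_int h * s) / D)"
    using Cons.IH HW by (simp_all add: D_def)
  have d: "of_int d + of_int d * s = D" by (simp add: D_def algebra_simps)
  show ?case
    using D by (simp add: HW peval_axpy peval_linmul W H d flip: D_def) (simp add: field_simps)
qed simp

lemma peval_nonneg: "list_all (\<lambda>a. 0 \<le> a) p \<Longrightarrow> s \<ge> 0 \<Longrightarrow> peval p s \<ge> 0"
  by (induction p) auto

lemma nonneg_onD:
  assumes p: "nonneg_on d l h p" and d: "d > 0"
    and x: "of_int l / of_int d \<le> x" "x < of_int h / of_int d"
  shows "peval p x \<ge> 0"
proof -
  \<comment> \<open>The inverse of the substitution. The right endpoint would need s = infinity,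
    which is why the intervals are half-open.\<close>
  define s where "s = (of_int d * x - of_int l) / (of_int h - of_int d * x)"
  have lh: "of_int l \<le> of_int d * x" "of_int d * x < of_int h"
    using x d by (simp_all add: field_simps)
  have s: "s \<ge> 0" using lh by (simp add: s_def)
  have "1 + s = (of_int h - of_int l) / (of_int h - of_int d * x)"
    using lh by (simp add: s_def field_simps)
  moreover have "of_int l + of_int h * s = of_int d * x * (of_int h - of_int l) / (of_int h -
      of_int d * x)"
    using lh by (simp add: s_def field_simps)
  ultimately have "(of_int l + of_int h * s) / (of_int d * (1 + s)) = x"
    using lh d by simp
  then have "peval (fst (moebius d l h p)) s = (of_int d * (1 + s)) ^ length p * peval p x"
    using peval_moebius[OF d s, of l h p] by simp
  moreover have "peval (fst (moebius d l h p)) s \<ge> 0"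
    using p s by (simp add: nonneg_on_def peval_nonneg)
  moreover have "(of_int d * (1 + s)) ^ length p > 0"
    using d s by simp
  ultimately show ?thesis by (simp add: zero_le_mult_iff)
qed

section \<open>The sums as polynomials in the cosine\<close>

text \<open>The factor \<open>262144 = 4 ^ 9\<close> clears the denominators of \<open>b 0, \<dots>, b 19\<close>.\<close>

definition Tstate :: "nat \<Rightarrow> int list \<Rightarrow> int list \<Rightarrow> int list \<Rightarrow> bool" where
  "Tstate n p q t \<longleftrightarrow> (\<forall>x. peval p (cos x) = cos (real n * x) \<and>
    peval q (cos x) = cos (real (Suc n) * x) \<and> peval t (cos x) = 262144 * T n x)"

lemma b_eq_cb: "b n = cb (n div 2)"
  by (simp add: b_def cb_def)

lemma cb_1: "cb (Suc 0) = 1 / 2"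
  by (simp add: cb_Suc)

text \<open>The recursion as a rewrite rule on numerals, with which the simplifier evaluates the
  weights \<open>w\<close> in the \<open>Tstate\<close> lemmas.\<close>

lemma cb_numeral: "cb (numeral k) = cb (pred_numeral k) * (numeral k - 1 / 2) / numeral k"
proof -
  have k: "numeral k = Suc (pred_numeral k)" by (rule numeral_eq_Suc)
  then have "real (pred_numeral k) = numeral k - 1"
    by (metis add_diff_cancel_right' of_nat_Suc of_nat_numeral add.commute)
  moreover have "cb (numeral k) = cb (pred_numeral k) * (2 * real (pred_numeral k) + 1) / (2 * real
      (pred_numeral k) + 2)"
    unfolding k by (rule cb_Suc)
  moreover have "(2 * (y - 1) + 1) / (2 * (y - 1) + 2) = (y - 1 / 2) / y" if "y > 0" for y :: real
    using that by (simp add: divide_simps)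
  ultimately show ?thesis
    by (metis times_divide_eq_right zero_less_numeral)
qed

lemma Tstate_0: "Tstate 0 [1] [0, 1] [262144]"
  using b_double[of 0] by (simp add: Tstate_def T_def)

text \<open>Chebyshev's recurrence cos ((m+1) x) = 2 cos x cos (m x) - cos ((m-1) x). The new lists
  enter through equations, so that the simplifier checks given literals.\<close>

lemma Tstate_Suc:
  assumes "Tstate n p q t" and n: "m = Suc n" and w: "of_int w = 262144 * b m"
    and "axpy (- 1) p (linmul 0 2 0 q) = r" "axpy w q t = u"
  shows "Tstate m q r u"
  unfolding Tstate_def
proof
  fix x
  have e: "peval p (cos x) = cos (real n * x)" "peval q (cos x) = cos (real m * x)"
      "peval t (cos x) = 262144 * T n x"
    using assms(1) n by (simp_all add: Tstate_def)
  have "2 * cos x * cos (real m * x) = cos (real (Suc m) * x) + cos (real n * x)"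
    unfolding cos_plus_cos n by (simp add: algebra_simps add_divide_distrib)
  then show "peval q (cos x) = cos (real m * x) \<and> peval r (cos x) = cos (real (Suc m) * x) \<and>
      peval u (cos x) = 262144 * T m x"
    using T_Suc[of n x] unfolding assms(4,5)[symmetric] peval_axpy peval_linmul e w n[symmetric]
    by (simp add: algebra_simps)
qed

text \<open>An entry \<open>(l, h, u, v)\<close> is the line through \<open>(l/16, u)\<close> and \<open>(h/16, v)\<close>, a majorant of
  \<open>1229.1 (\<pi> - x)\<^sup>2\<close> as a function of \<open>cos x\<close> on \<open>[l/16, h/16]\<close>.\<close>

fun above_chord :: "int list \<Rightarrow> int \<times> int \<times> int \<times> int \<Rightarrow> bool" where
  "above_chord t (l, h, u, v) = nonneg_on 16 l h
    (axpy (10000 * (h + - l)) t [262144 * (v * l + - (u * h)), 4194304 * (u + - v)])"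

lemma above_chordD:
  assumes c: "above_chord t (l, h, u, v)" and s: "Tstate n p q t"
    and x: "of_int l / 16 \<le> cos x" "cos x < of_int h / 16"
  shows "of_int u * (of_int h - 16 * cos x) + of_int v * (16 * cos x - of_int l)
    \<le> 10000 * (of_int h - of_int l) * T n x"
proof -
  have "0 \<le> peval (axpy (10000 * (h + - l)) t [262144 * (v * l + - (u * h)), 4194304 * (u + - v)])
      (cos x)"
    by (rule nonneg_onD[of 16 l h]) (use c x in \<open>simp_all\<close>)
  also have "\<dots> = 262144 * (10000 * (of_int h - of_int l) * T n x
      - (of_int u * (of_int h - 16 * cos x) + of_int v * (16 * cos x - of_int l)))"
    using s by (simp add: peval_axpy Tstate_def algebra_simps)
  finally show ?thesis by (simp add: zero_le_mult_iff)
qed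

text \<open>Rewrite rules that reduce a sign certificate to numeral arithmetic and then to
  True.\<close>

lemmas nonneg_on_eval = nonneg_on_def moebius.simps moebius_step.simps
  moebius_cons.simps above_chord.simps axpy.simps linmul.simps
  list.pred_inject fst_conv snd_conv arith_simps rel_simps mult_1_left mult_1_right mult_minus_left
      mult_minus_right minus_minus
  add_neg_numeral_special numeral_One order_refl zero_le_one simp_thms

section \<open>Piecewise linear majorants\<close>

lemma Maclaurin_cos_bound: "\<bar>cos x - (\<Sum>m<n. cos_coeff m * x ^ m)\<bar> \<le> \<bar>x\<bar> ^ n / fact n" for x :: real
proof -
  obtain t where "cos x = (\<Sum>m<n. cos_coeff m * x ^ m) + (cos (t + 1 / 2 * real n * pi) / fact n) *
      x ^ n"
    using Maclaurin_cos_expansion by blast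
  then have "\<bar>cos x - (\<Sum>m<n. cos_coeff m * x ^ m)\<bar> = \<bar>cos (t + 1 / 2 * real n * pi)\<bar> * (\<bar>x\<bar> ^ n /
      fact n)"
    by (simp add: abs_mult power_abs)
  also have "\<dots> \<le> 1 * (\<bar>x\<bar> ^ n / fact n)"
    by (rule mult_right_mono) auto
  finally show ?thesis by simp
qed

lemma cos_approx_10:
  fixes x :: real
  shows "\<bar>cos x - (1 - x ^ 2 / 2 + x ^ 4 / 24 - x ^ 6 / 720 + x ^ 8 / 40320)\<bar> \<le> x ^ 10 / 3628800"
proof -
  have "(\<Sum>m<10. cos_coeff m * x ^ m) = 1 - x ^ 2 / 2 + x ^ 4 / 24 - x ^ 6 / 720 + x ^ 8 / 40320"
    by (simp add: eval_nat_numeral cos_coeff_Suc sin_coeff_Suc)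
  from Maclaurin_cos_bound[of x 10, unfolded this] show ?thesis
    by (simp add: fact_numeral)
qed

lemma cos_lower_6:
  fixes x :: real
  shows "1 - x ^ 2 / 2 + x ^ 4 / 24 - x ^ 6 / 720 \<le> cos x"
proof -
  have "(\<Sum>m<6. cos_coeff m * x ^ m) = 1 - x ^ 2 / 2 + x ^ 4 / 24"
    by (simp add: eval_nat_numeral cos_coeff_Suc sin_coeff_Suc)
  from Maclaurin_cos_bound[of x 6, unfolded this] have "\<bar>cos x - (1 - x ^ 2 / 2 + x ^ 4 / 24)\<bar>
      \<le> x ^ 6 / 720"
    by (simp add: fact_numeral)
  then show ?thesis by (simp only: abs_le_iff) linarith
qed

lemma cos_lower_2:
  fixes x :: real
  shows "1 - x ^ 2 / 2 \<le> cos x"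
proof -
  have "(\<Sum>m<2. cos_coeff m * x ^ m) = 1"
    by (simp add: eval_nat_numeral cos_coeff_Suc sin_coeff_Suc)
  from Maclaurin_cos_bound[of x 2, unfolded this] have "\<bar>cos x - 1\<bar> \<le> x ^ 2 / 2"
    by (simp add: fact_numeral)
  then show ?thesis by (simp only: abs_le_iff) linarith
qed

lemma cos_upper_4:
  fixes x :: real
  shows "cos x \<le> 1 - x ^ 2 / 2 + x ^ 4 / 24"
proof -
  have "(\<Sum>m<4. cos_coeff m * x ^ m) = 1 - x ^ 2 / 2"
    by (simp add: eval_nat_numeral cos_coeff_Suc sin_coeff_Suc)
  from Maclaurin_cos_bound[of x 4, unfolded this] have "\<bar>cos x - (1 - x ^ 2 / 2)\<bar> \<le> x ^ 4 / 24"
    by (simp add: fact_numeral)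
  then show ?thesis by (simp only: abs_le_iff) linarith
qed

lemma sin_lower_3:
  fixes x :: real
  assumes "0 \<le> x"
  shows "x - x ^ 3 / 6 \<le> sin x"
proof -
  have "(\<Sum>m<3. sin_coeff m * x ^ m) = x"
    by (simp add: eval_nat_numeral cos_coeff_Suc sin_coeff_Suc)
  from Maclaurin_sin_bound[of x 3, unfolded this] have "\<bar>sin x - x\<bar> \<le> x ^ 3 / 6"
    using assms by (simp add: fact_numeral)
  then show ?thesis by (simp only: abs_le_iff) linarith
qed

lemma sin_approx_9:
  fixes x :: real
  assumes "0 \<le> x"
  shows "\<bar>sin x - (x - x ^ 3 / 6 + x ^ 5 / 120 - x ^ 7 / 5040)\<bar> \<le> x ^ 9 / 362880"
proof -
  have "(\<Sum>m<9. sin_coeff m * x ^ m) = x - x ^ 3 / 6 + x ^ 5 / 120 - x ^ 7 / 5040"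
    by (simp add: eval_nat_numeral cos_coeff_Suc sin_coeff_Suc)
  from Maclaurin_sin_bound[of x 9, unfolded this] show ?thesis
    using assms by (simp add: fact_numeral)
qed

lemma pi_bounds: "(15707963 / 5000000) < pi" "pi < (31415927 / 10000000)"
  using pi_approx by simp_all

text \<open>On this range 1 - cos u >= u^2 (1/2 - u^2/24) > 0.397 u^2, and 3100 * 0.397 exceeds
  1229.1 = 10^4 * 0.12291.\<close>

lemma one_minus_cos_lower:
  fixes u :: real
  assumes "0 \<le> u" "u \<le> pi / 2"
  shows "(12291 / 10) * u\<^sup>2 \<le> 3100 * (1 - cos u)"
proof -
  have "u \<le> 3927 / 2500" using assms pi_bounds by linarith
  then have "u\<^sup>2 \<le> (3927 / 2500)\<^sup>2" using assms by (intro power_mono) auto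
  then have "u\<^sup>2 \<le> 24675 / 10000" by (simp add: power2_eq_square)
  then have "u\<^sup>2 * u\<^sup>2 \<le> u\<^sup>2 * (24675 / 10000)"
    by (intro mult_left_mono) auto
  moreover have "u ^ 4 = u\<^sup>2 * u\<^sup>2" by (simp flip: power_add)
  moreover have "0 \<le> u\<^sup>2" by simp
  ultimately show ?thesis using cos_upper_4[of u] by argo
qed

section \<open>Chord majorants of the squared arccosine\<close>

lemma arccos_square_le:
  assumes "0 \<le> \<rho>" "\<rho> \<le> pi" "c \<le> cos \<rho>" "-1 \<le> c" "c \<le> 1" and
      "(12291 / 10) * ((31415927 / 10000000) - \<rho>)\<^sup>2 \<le> v"
  shows "(12291 / 10) * (pi - arccos c)\<^sup>2 \<le> v"
proof -
  \<comment> \<open>\<open>\<rho>\<close> is a rational lower approximation of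
    \<open>arccos c\<close>; together with a rational upper bound for pi it gives a rational bound
    on the square.\<close>
  have "arccos c \<ge> arccos (cos \<rho>)"
    using assms by (intro arccos_le_arccos) auto
  then have "\<rho> \<le> arccos c" using assms by (simp add: arccos_cos)
  moreover have "arccos c \<le> pi" using assms by (simp add: arccos_ubound)
  ultimately have "(pi - arccos c)\<^sup>2 \<le> ((31415927 / 10000000) - \<rho>)\<^sup>2"
    using pi_bounds by (intro power_mono) auto
  then show ?thesis using assms(6) by linarith
qed

text \<open>Convexity in c is shown without differentiating arccos: as a function of t = arccos c,
  chord minus square is concave on [0, pi/2], because \<open>u \<le> v\<close> and cos t >= 0, and
  it is nonnegative at both ends.\<close>

lemma chord_upper:
  fixes l h u v \<kappa> :: real
  assumes lh: "0 \<le> l" "l < h" "h \<le> 1" and uv: "u \<le> v" and \<kappa>: "\<kappa> \<ge> 0"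
    and u: "\<kappa> * (pi - arccos l)\<^sup>2 \<le> u" and v: "\<kappa> * (pi - arccos h)\<^sup>2 \<le> v"
    and x: "0 \<le> x" "x \<le> pi" "l \<le> cos x" "cos x \<le> h"
  shows "\<kappa> * (pi - x)\<^sup>2 * (h - l) \<le> u * (h - cos x) + v * (cos x - l)"
proof -
  define D where "D = (\<lambda>t. u * (h - cos t) + v * (cos t - l) - \<kappa> * (pi - t)\<^sup>2 * (h - l))"
  have "concave_on {0..pi / 2} D"
  proof (rule f''_le0_imp_concave)
    fix t :: real
    assume t: "t \<in> {0..pi / 2}"
    show "(D has_real_derivative (u - v) * sin t + 2 * \<kappa> * (pi - t) * (h - l)) (at t)"
      unfolding D_def by (auto intro!: derivative_eq_intros simp: algebra_simps power2_eq_square)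
    show "((\<lambda>t. (u - v) * sin t + 2 * \<kappa> * (pi - t) * (h - l)) has_real_derivative
        (u - v) * cos t - 2 * \<kappa> * (h - l)) (at t)"
      by (auto intro!: derivative_eq_intros simp: algebra_simps power2_eq_square)
    have "0 \<le> cos t" using t by (intro cos_ge_zero) auto
    then have "(u - v) * cos t \<le> 0" using uv by (simp add: mult_nonpos_nonneg)
    then show "(u - v) * cos t - 2 * \<kappa> * (h - l) \<le> 0" using lh \<kappa> by (smt (verit) mult_nonneg_nonneg)
  qed simp
  moreover have "arccos h \<le> x" "x \<le> arccos l"
    using arccos_le_arccos[of "cos x" h] arccos_le_arccos[of l "cos x"] x lh
        by (simp_all add: arccos_cos)
  moreover have "arccos h \<in> {0..pi / 2}" "arccos l \<in> {0..pi / 2}"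
    using lh arccos_le_pi2[of h] arccos_le_pi2[of l] by (auto intro: arccos_lbound)
  moreover have "D (arccos h) \<ge> 0"
    using mult_right_mono[OF v, of "h - l"] lh by (simp add: D_def algebra_simps)
  moreover have "D (arccos l) \<ge> 0"
    using mult_right_mono[OF u, of "h - l"] lh by (simp add: D_def algebra_simps)
  ultimately have "D x \<ge> 0"
  proof -
    assume c: "concave_on {0..pi / 2} D" and le: "arccos h \<le> x" "x \<le> arccos l"
      and mem: "arccos h \<in> {0..pi / 2}" "arccos l \<in> {0..pi / 2}"
      and nn: "D (arccos h) \<ge> 0" "D (arccos l) \<ge> 0"
    have "x \<in> closed_segment (arccos h) (arccos l)"
      using le by (simp add: closed_segment_eq_real_ivl)
    then obtain s where s: "0 \<le> s" "s \<le> 1" "x = (1 - s) *\<^sub>R arccos h + s *\<^sub>R arccos l"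
      by (auto simp: in_segment)
    have "D x \<ge> (1 - s) * D (arccos h) + s * D (arccos l)"
      unfolding s(3) by (rule concave_onD[OF c]) (use s mem in auto)
    moreover have "(1 - s) * D (arccos h) + s * D (arccos l) \<ge> 0"
      using s nn by (intro add_nonneg_nonneg mult_nonneg_nonneg) auto
    ultimately show ?thesis by linarith
  qed
  then show ?thesis by (simp add: D_def)
qed

definition majorizes :: "int \<times> int \<times> int \<times> int \<Rightarrow> bool" where
  "majorizes = (\<lambda>(l, h, u, v). \<forall>x. 0 \<le> x \<longrightarrow> x \<le> pi \<longrightarrow> of_int l / 16 \<le> cos x \<longrightarrow> cos x < of_int h / 16 \<longrightarrow>
    (12291 / 10) * (pi - x)\<^sup>2 * (of_int h - of_int l) \<le> of_int u * (of_int h - 16 * cos x) + of_int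
        v * (16 * cos x - of_int l))"

lemma majorizes_neg:
  assumes "h \<le> 0" "-16 \<le> l" "l < h" "775 * (16 + l) \<le> 4 * u" "775 * (16 + h) \<le> 4 * v"
  shows "majorizes (l, h, u, v)"
  unfolding majorizes_def prod.case
proof (intro allI impI)
  fix x
  assume x: "0 \<le> x" "x \<le> pi" "of_int l / 16 \<le> cos x" "cos x < of_int h / 16"
  have lh: "real_of_int l < of_int h" "real_of_int h \<le> 0" using assms by auto
  have "x \<ge> pi / 2"
  proof (rule ccontr)
    assume "\<not> x \<ge> pi / 2"
    then have "cos x > 0" using x by (intro cos_gt_zero_pi) auto
    then show False using x lh by auto
  qed
  then have "(12291 / 10) * (pi - x)\<^sup>2 \<le> 3100 * (1 - cos (pi - x))"
    using x by (intro one_minus_cos_lower) auto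
  then have "(12291 / 10) * (pi - x)\<^sup>2 * (of_int h - of_int l)
      \<le> 3100 * (1 + cos x) * (of_int h - of_int l)"
    using lh by (intro mult_right_mono) auto
  also have "\<dots> = 775 / 4 * (16 + of_int l) * (of_int h - 16 * cos x) + 775 / 4 * (16 + of_int h) *
      (16 * cos x - of_int l)"
    by (simp add: field_simps)
  also have "\<dots> \<le> of_int u * (of_int h - 16 * cos x) + of_int v * (16 * cos x - of_int l)"
  proof (intro add_mono mult_right_mono)
    show "775 / 4 * (16 + real_of_int l) \<le> of_int u" "775 / 4 * (16 + real_of_int h) \<le> of_int v"
      using assms(4,5)[THEN of_int_le_iff[where 'a = real, THEN iffD2]] by simp_all
  qed (use x in auto)
  finally show "(12291 / 10) * (pi - x)\<^sup>2 * (of_int h - of_int l)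
      \<le> of_int u * (of_int h - 16 * cos x) + of_int v * (16 * cos x - of_int l)" .
qed

lemma majorizes_nonneg:
  assumes "0 \<le> l" "l < h" "h \<le> 16" "u \<le> v"
    and "(12291 / 10) * (pi - arccos (of_int l / 16))\<^sup>2 \<le> of_int u"
    and "(12291 / 10) * (pi - arccos (of_int h / 16))\<^sup>2 \<le> of_int v"
  shows "majorizes (l, h, u, v)"
  unfolding majorizes_def prod.case
proof (intro allI impI)
  fix x
  assume x: "0 \<le> x" "x \<le> pi" "of_int l / 16 \<le> cos x" "cos x < of_int h / 16"
  have "(12291 / 10) * (pi - x)\<^sup>2 * (of_int h / 16 - of_int l / 16)
      \<le> of_int u * (of_int h / 16 - cos x) + of_int v * (cos x - of_int l / 16)"
    by (rule chord_upper) (use assms x in auto)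
  then show "(12291 / 10) * (pi - x)\<^sup>2 * (of_int h - of_int l)
      \<le> of_int u * (of_int h - 16 * cos x) + of_int v * (16 * cos x - of_int l)"
    by (simp add: field_simps)
qed

text \<open>Nodes l/16 with l >= 0 carry integers slightly above 1229.1 (pi - arccos (l/16))^2; on
  the negative side they lie on or just above the line of \<open>majorizes_neg\<close>, and the
  subdivision serves the coefficient test of \<open>nonneg_on\<close>. Cells are narrowest towards c
  = 1, where the curve bends most. The node 0 has two ordinates, one from each side.\<close>

definition chords :: "(int \<times> int \<times> int \<times> int) list" where
  "chords = [(-16, -14, 0, 388), (-14, -12, 388, 775), (-12, -8, 775, 1550), (-8, 0, 1550, 3100),
      (0, 4,
    3033, 4088), (4, 8, 4088, 5392), (8, 10, 5392, 6201), (10, 11, 6201, 6667), (11, 12, 6667,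
    7192), (12, 13, 7192, 7801), (13, 14, 7801, 8543), (14, 15, 8543, 9542), (15, 16, 9542,
    12132)]"

text \<open>The cell [11/16, 12/16] is missing: it contains cos \<open>t0\<close> = 0.7474..., where
  \<open>T 6\<close> drops below 0.12291 (pi - x)^2 (\<open>T_6_t0_less\<close>).\<close>

definition chords_6 :: "(int \<times> int \<times> int \<times> int) list" where
  "chords_6 = [(-16, -14, 0, 388), (-14, -12, 388, 775), (-12, -8, 775, 1550), (-8, 0, 1550, 3100),
      (0, 4,
    3033, 4088), (4, 8, 4088, 5392), (8, 10, 5392, 6201), (10, 11, 6201, 6667), (12, 13, 7192,
    7801), (13, 14, 7801, 8543), (14, 15, 8543, 9542), (15, 16, 9542, 12132)]"

lemma chords_majorize: "list_all majorizes chords"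
proof -
  have n0: "(12291 / 10) * (pi - arccos (of_int 0 / 16))\<^sup>2 \<le> of_int 3033"
  proof (rule arccos_square_le[of "1570796 / 1000000"])
    show "of_int 0 / 16 \<le> cos (1570796 / 1000000 :: real)"
      using pi_bounds by (simp, intro cos_ge_zero) auto
  qed (use pi_bounds in \<open>auto simp: power2_eq_square\<close>)
  \<comment> \<open>The values of \<open>\<rho>\<close> used below are arccos (c/16) rounded
    down.\<close>
  have *: "(12291 / 10) * (pi - arccos (c / 16))\<^sup>2 \<le> v"
    if "0 \<le> \<rho>" "\<rho> \<le> 3" "(12291 / 10) * ((31415927 / 10000000) - \<rho>)\<^sup>2 \<le> v" "0 \<le> c" "c \<le> 16"
      "c / 16 \<le> 1 - \<rho> ^ 2 / 2 + \<rho> ^ 4 / 24 - \<rho> ^ 6 / 720 + \<rho> ^ 8 / 40320 - \<rho> ^ 10 / 3628800"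
    for \<rho> c v :: real
  proof (rule arccos_square_le[of \<rho>])
    show "\<rho> \<le> pi" using that(2) pi_bounds by linarith
    show "c / 16 \<le> cos \<rho>" using that(6) cos_approx_10[of \<rho>] by argo
  qed (use that in auto)
  have n4: "(12291 / 10) * (pi - arccos (of_int 4 / 16))\<^sup>2 \<le> of_int 4088"
    by (rule *[of "659/500"]) (simp_all add: power_divide)
  have n8: "(12291 / 10) * (pi - arccos (of_int 8 / 16))\<^sup>2 \<le> of_int 5392"
    by (rule *[of "20943/20000"]) (simp_all add: power_divide)
  have n10: "(12291 / 10) * (pi - arccos (of_int 10 / 16))\<^sup>2 \<le> of_int 6201"
    by (rule *[of "17911/20000"]) (simp_all add: power_divide)
  have n11: "(12291 / 10) * (pi - arccos (of_int 11 / 16))\<^sup>2 \<le> of_int 6667"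
    by (rule *[of "8127/10000"]) (simp_all add: power_divide)
  have n12: "(12291 / 10) * (pi - arccos (of_int 12 / 16))\<^sup>2 \<le> of_int 7192"
    by (rule *[of "7227/10000"]) (simp_all add: power_divide)
  have n13: "(12291 / 10) * (pi - arccos (of_int 13 / 16))\<^sup>2 \<le> of_int 7801"
    by (rule *[of "6223/10000"]) (simp_all add: power_divide)
  have n14: "(12291 / 10) * (pi - arccos (of_int 14 / 16))\<^sup>2 \<le> of_int 8543"
    by (rule *[of "5053/10000"]) (simp_all add: power_divide)
  have n15: "(12291 / 10) * (pi - arccos (of_int 15 / 16))\<^sup>2 \<le> of_int 9542"
    by (rule *[of "1777/5000"]) (simp_all add: power_divide)
  have n16: "(12291 / 10) * (pi - arccos (of_int 16 / 16))\<^sup>2 \<le> of_int 12132"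
    by (rule *[of "0"]) (simp_all add: power_divide)
  show ?thesis
    unfolding chords_def list.pred_inject
  proof (intro conjI)
    show "majorizes (-16, -14, 0, 388)" by (rule majorizes_neg) simp_all
    show "majorizes (-14, -12, 388, 775)" by (rule majorizes_neg) simp_all
    show "majorizes (-12, -8, 775, 1550)" by (rule majorizes_neg) simp_all
    show "majorizes (-8, 0, 1550, 3100)" by (rule majorizes_neg) simp_all
    show "majorizes (0, 4, 3033, 4088)" by (rule majorizes_nonneg[OF _ _ _ _ n0 n4]) simp_all
    show "majorizes (4, 8, 4088, 5392)" by (rule majorizes_nonneg[OF _ _ _ _ n4 n8]) simp_all
    show "majorizes (8, 10, 5392, 6201)" by (rule majorizes_nonneg[OF _ _ _ _ n8 n10]) simp_all
    show "majorizes (10, 11, 6201, 6667)" by (rule majorizes_nonneg[OF _ _ _ _ n10 n11]) simp_all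
    show "majorizes (11, 12, 6667, 7192)" by (rule majorizes_nonneg[OF _ _ _ _ n11 n12]) simp_all
    show "majorizes (12, 13, 7192, 7801)" by (rule majorizes_nonneg[OF _ _ _ _ n12 n13]) simp_all
    show "majorizes (13, 14, 7801, 8543)" by (rule majorizes_nonneg[OF _ _ _ _ n13 n14]) simp_all
    show "majorizes (14, 15, 8543, 9542)" by (rule majorizes_nonneg[OF _ _ _ _ n14 n15]) simp_all
    show "majorizes (15, 16, 9542, 12132)" by (rule majorizes_nonneg[OF _ _ _ _ n15 n16]) simp_all
  qed simp
qed

section \<open>Certificates for n up to 19\<close>

lemma Tstate_1: "Tstate 1
    [0, 1]
    [-1, 0, 2]
    [262144, 262144]"
  by (rule Tstate_Suc[OF Tstate_0, where w = 262144])
    (simp_all add: b_eq_cb cb_1 cb_numeral)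

lemma Tstate_2: "Tstate 2
    [-1, 0, 2]
    [0, -3, 0, 4]
    [131072, 262144, 262144]"
  by (rule Tstate_Suc[OF Tstate_1, where w = 131072])
    (simp_all add: b_eq_cb cb_1 cb_numeral)

lemma Tstate_3: "Tstate 3
    [0, -3, 0, 4]
    [1, 0, -8, 0, 8]
    [131072, -131072, 262144, 524288]"
  by (rule Tstate_Suc[OF Tstate_2, where w = 131072])
    (simp_all add: b_eq_cb cb_1 cb_numeral)

lemma Tstate_4: "Tstate 4
    [1, 0, -8, 0, 8]
    [0, 5, 0, -20, 0, 16]
    [229376, -131072, -524288, 524288, 786432]"
  by (rule Tstate_Suc[OF Tstate_3, where w = 98304])
    (simp_all add: b_eq_cb cb_1 cb_numeral)

lemma Tstate_5: "Tstate 5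
    [0, 5, 0, -20, 0, 16]
    [-1, 0, 18, 0, -48, 0, 32]
    [229376, 360448, -524288, -1441792, 786432, 1572864]"
  by (rule Tstate_Suc[OF Tstate_4, where w = 98304])
    (simp_all add: b_eq_cb cb_1 cb_numeral)

lemma Tstate_6: "Tstate 6
    [-1, 0, 18, 0, -48, 0, 32]
    [0, -7, 0, 56, 0, -112, 0, 64]
    [147456, 360448, 950272, -1441792, -3145728, 1572864, 2621440]"
  by (rule Tstate_Suc[OF Tstate_5, where w = 81920])
    (simp_all add: b_eq_cb cb_1 cb_numeral)

lemma Tstate_7: "Tstate 7
    [0, -7, 0, 56, 0, -112, 0, 64]
    [1, 0, -32, 0, 160, 0, -256, 0, 128]
    [147456, -212992, 950272, 3145728, -3145728, -7602176, 2621440, 5242880]"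
  by (rule Tstate_Suc[OF Tstate_6, where w = 81920])
    (simp_all add: b_eq_cb cb_1 cb_numeral)

lemma Tstate_8: "Tstate 8
    [1, 0, -32, 0, 160, 0, -256, 0, 128]
    [0, 9, 0, -120, 0, 432, 0, -576, 0, 256]
    [219136, -212992, -1343488, 3145728, 8323072, -7602176, -15728640, 5242880, 9175040]"
  by (rule Tstate_Suc[OF Tstate_7, where w = 71680])
    (simp_all add: b_eq_cb cb_1 cb_numeral)

lemma Tstate_9: "Tstate 9
    [0, 9, 0, -120, 0, 432, 0, -576, 0, 256]
    [-1, 0, 50, 0, -400, 0, 1120, 0, -1280, 0, 512]
    [219136, 432128, -1343488, -5455872, 8323072, 23363584, -15728640, -36044800, 9175040,
    18350080]"
  by (rule Tstate_Suc[OF Tstate_8, where w = 71680])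
    (simp_all add: b_eq_cb cb_1 cb_numeral)

lemma Tstate_10: "Tstate 10
    [-1, 0, 50, 0, -400, 0, 1120, 0, -1280, 0, 512]
    [0, -11, 0, 220, 0, -1232, 0, 2816, 0, -2816, 0, 1024]
    [154624, 432128, 1882112, -5455872, -17481728, 23363584, 56524800, -36044800, -73400320,
    18350080, 33030144]"
  by (rule Tstate_Suc[OF Tstate_9, where w = 64512])
    (simp_all add: b_eq_cb cb_1 cb_numeral)

lemma Tstate_11: "Tstate 11
    [0, -11, 0, 220, 0, -1232, 0, 2816, 0, -2816, 0, 1024]
    [1, 0, -72, 0, 840, 0, -3584, 0, 6912, 0, -6144, 0, 2048]
    [154624, -277504, 1882112, 8736768, -17481728, -56115200, 56524800, 145620992, -73400320,
    -163315712, 33030144, 66060288]"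
  by (rule Tstate_Suc[OF Tstate_10, where w = 64512])
    (simp_all add: b_eq_cb cb_1 cb_numeral)

lemma Tstate_12: "Tstate 12
    [1, 0, -72, 0, 840, 0, -3584, 0, 6912, 0, -6144, 0, 2048]
    [0, 13, 0, -364, 0, 2912, 0, -9984, 0, 16640, 0, -13312, 0, 4096]
    [213760, -277504, -2375680, 8736768, 32192512, -56115200, -155418624, 145620992, 335347712,
    -163315712, -330301440, 66060288, 121110528]"
  by (rule Tstate_Suc[OF Tstate_11, where w = 59136])
    (simp_all add: b_eq_cb cb_1 cb_numeral)

lemma Tstate_13: "Tstate 13
    [0, 13, 0, -364, 0, 2912, 0, -9984, 0, 16640, 0, -13312, 0, 4096]
    [-1, 0, 98, 0, -1568, 0, 9408, 0, -26880, 0, 39424, 0, -28672, 0, 8192]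
    [213760, 491264, -2375680, -12788736, 32192512, 116088832, -155418624, -444792832,
    335347712, 820707328, -330301440, -721158144, 121110528, 242221056]"
  by (rule Tstate_Suc[OF Tstate_12, where w = 59136])
    (simp_all add: b_eq_cb cb_1 cb_numeral)

lemma Tstate_14: "Tstate 14
    [-1, 0, 98, 0, -1568, 0, 9408, 0, -26880, 0, 39424, 0, -28672, 0, 8192]
    [0, -15, 0, 560, 0, -6048, 0, 28800, 0, -70400, 0, 92160, 0, -61440, 0, 16384]
    [158848, 491264, 3005696, -12788736, -53909504, 116088832, 361193472, -444792832,
    -1140686848, 820707328, 1834549248, -721158144, -1453326336, 242221056, 449839104]"
  by (rule Tstate_Suc[OF Tstate_13, where w = 54912])
    (simp_all add: b_eq_cb cb_1 cb_numeral)

lemma Tstate_15: "Tstate 15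
    [0, -15, 0, 560, 0, -6048, 0, 28800, 0, -70400, 0, 92160, 0, -61440, 0, 16384]
    [1, 0, -128, 0, 2688, 0, -21504, 0, 84480, 0, -180224, 0, 212992, 0, -131072, 0, 32768]
    [158848, -332416, 3005696, 17961984, -53909504, -216018944, 361193472, 1136672768,
    -1140686848, -3045097472, 1834549248, 4339531776, -1453326336, -3131572224, 449839104,
    899678208]"
  by (rule Tstate_Suc[OF Tstate_14, where w = 54912])
    (simp_all add: b_eq_cb cb_1 cb_numeral)

lemma Tstate_16: "Tstate 16
    [1, 0, -128, 0, 2688, 0, -21504, 0, 84480, 0, -180224, 0, 212992, 0, -131072, 0, 32768]
    [0, 17, 0, -816, 0, 11424, 0, -71808, 0, 239360, 0, -452608, 0, 487424, 0, -278528, 0,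
    65536]
    [210328, -332416, -3583744, 17961984, 84468736, -216018944, -745832448, 1136672768,
    3208343552, -3045097472, -7443382272, 4339531776, 9511501824, -3131572224, -6297747456,
    899678208, 1686896640]"
  by (rule Tstate_Suc[OF Tstate_15, where w = 51480])
    (simp_all add: b_eq_cb cb_1 cb_numeral)

lemma Tstate_17: "Tstate 17
    [0, 17, 0, -816, 0, 11424, 0, -71808, 0, 239360, 0, -452608, 0, 487424, 0, -278528, 0,
    65536]
    [-1, 0, 162, 0, -4320, 0, 44352, 0, -228096, 0, 658944, 0, -1118208, 0, 1105920, 0, -589824,
    0, 131072]
    [210328, 542744, -3583744, -24045696, 84468736, 372088576, -745832448, -2560003072,
    3208343552, 9277155328, -7443382272, -18960728064, 9511501824, 21961015296, -6297747456,
    -13438943232, 1686896640, 3373793280]"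
  by (rule Tstate_Suc[OF Tstate_16, where w = 51480])
    (simp_all add: b_eq_cb cb_1 cb_numeral)

lemma Tstate_18: "Tstate 18
    [-1, 0, 162, 0, -4320, 0, 44352, 0, -228096, 0, 658944, 0, -1118208, 0, 1105920, 0, -589824,
    0, 131072]
    [0, -19, 0, 1140, 0, -20064, 0, 160512, 0, -695552, 0, 1770496, 0, -2723840, 0, 2490368, 0,
    -1245184, 0, 262144]
    [161708, 542744, 4292696, -24045696, -125569664, 372088576, 1410561792, -2560003072,
    -7881683968, 9277155328, 24594475008, -18960728064, -44855771136, 21961015296, 47472082944,
    -13438943232, -26990346240, 3373793280, 6372720640]"
  by (rule Tstate_Suc[OF Tstate_17, where w = 48620])
    (simp_all add: b_eq_cb cb_1 cb_numeral)

lemma Tstate_19: "Tstate 19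
    [0, -19, 0, 1140, 0, -20064, 0, 160512, 0, -695552, 0, 1770496, 0, -2723840, 0, 2490368, 0,
    -1245184, 0, 262144]
    [1, 0, -200, 0, 6600, 0, -84480, 0, 549120, 0, -2050048, 0, 4659200, 0, -6553600, 0,
    5570560, 0, -2621440, 0, 524288]
    [161708, -381036, 4292696, 31381104, -125569664, -603423104, 1410561792, 5244090368,
    -7881683968, -24540582912, 24594475008, 67120787456, -44855771136, -110472085504,
    47472082944, 107642748928, -26990346240, -57167052800, 6372720640, 12745441280]"
  by (rule Tstate_Suc[OF Tstate_18, where w = 48620])
    (simp_all add: b_eq_cb cb_1 cb_numeral)

section \<open>Sign certificates: each sum lies above the chords\<close>

lemma above_chords_1: "list_all (above_chord
    [262144, 262144]) chords"
  by (simp only: chords_def nonneg_on_eval)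

lemma above_chords_2: "list_all (above_chord
    [131072, 262144, 262144]) chords"
  by (simp only: chords_def nonneg_on_eval)

lemma above_chords_3: "list_all (above_chord
    [131072, -131072, 262144, 524288]) chords"
  by (simp only: chords_def nonneg_on_eval)

lemma above_chords_4: "list_all (above_chord
    [229376, -131072, -524288, 524288, 786432]) chords"
  by (simp only: chords_def nonneg_on_eval)

lemma above_chords_5: "list_all (above_chord
    [229376, 360448, -524288, -1441792, 786432, 1572864]) chords"
  by (simp only: chords_def nonneg_on_eval)

lemma above_chords_6: "list_all (above_chord
    [147456, 360448, 950272, -1441792, -3145728, 1572864, 2621440]) chords_6"
  by (simp only: chords_6_def nonneg_on_eval)

lemma above_chords_7: "list_all (above_chord
    [147456, -212992, 950272, 3145728, -3145728, -7602176, 2621440, 5242880]) chords"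
  by (simp only: chords_def nonneg_on_eval)

lemma above_chords_8: "list_all (above_chord
    [219136, -212992, -1343488, 3145728, 8323072, -7602176, -15728640, 5242880, 9175040]) chords"
  by (simp only: chords_def nonneg_on_eval)

lemma above_chords_9: "list_all (above_chord
    [219136, 432128, -1343488, -5455872, 8323072, 23363584, -15728640, -36044800, 9175040,
    18350080]) chords"
  by (simp only: chords_def nonneg_on_eval)

lemma above_chords_10: "list_all (above_chord
    [154624, 432128, 1882112, -5455872, -17481728, 23363584, 56524800, -36044800, -73400320,
    18350080, 33030144]) chords"
  by (simp only: chords_def nonneg_on_eval)

lemma above_chords_11: "list_all (above_chord
    [154624, -277504, 1882112, 8736768, -17481728, -56115200, 56524800, 145620992, -73400320,
    -163315712, 33030144, 66060288]) chords"
  by (simp only: chords_def nonneg_on_eval)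

lemma above_chords_12: "list_all (above_chord
    [213760, -277504, -2375680, 8736768, 32192512, -56115200, -155418624, 145620992, 335347712,
    -163315712, -330301440, 66060288, 121110528]) chords"
  by (simp only: chords_def nonneg_on_eval)

lemma above_chords_13: "list_all (above_chord
    [213760, 491264, -2375680, -12788736, 32192512, 116088832, -155418624, -444792832,
    335347712, 820707328, -330301440, -721158144, 121110528, 242221056]) chords"
  by (simp only: chords_def nonneg_on_eval)

lemma above_chords_14: "list_all (above_chord
    [158848, 491264, 3005696, -12788736, -53909504, 116088832, 361193472, -444792832,
    -1140686848, 820707328, 1834549248, -721158144, -1453326336, 242221056, 449839104]) chords"
  by (simp only: chords_def nonneg_on_eval)

lemma above_chords_15: "list_all (above_chord
    [158848, -332416, 3005696, 17961984, -53909504, -216018944, 361193472, 1136672768,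
    -1140686848, -3045097472, 1834549248, 4339531776, -1453326336, -3131572224, 449839104,
    899678208]) chords"
  by (simp only: chords_def nonneg_on_eval)

lemma above_chords_16: "list_all (above_chord
    [210328, -332416, -3583744, 17961984, 84468736, -216018944, -745832448, 1136672768,
    3208343552, -3045097472, -7443382272, 4339531776, 9511501824, -3131572224, -6297747456,
    899678208, 1686896640]) chords"
  by (simp only: chords_def nonneg_on_eval)

lemma above_chords_17: "list_all (above_chord
    [210328, 542744, -3583744, -24045696, 84468736, 372088576, -745832448, -2560003072,
    3208343552, 9277155328, -7443382272, -18960728064, 9511501824, 21961015296, -6297747456,
    -13438943232, 1686896640, 3373793280]) chords"
  by (simp only: chords_def nonneg_on_eval)

lemma above_chords_18: "list_all (above_chord
    [161708, 542744, 4292696, -24045696, -125569664, 372088576, 1410561792, -2560003072,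
    -7881683968, 9277155328, 24594475008, -18960728064, -44855771136, 21961015296, 47472082944,
    -13438943232, -26990346240, 3373793280, 6372720640]) chords"
  by (simp only: chords_def nonneg_on_eval)

lemma above_chords_19: "list_all (above_chord
    [161708, -381036, 4292696, 31381104, -125569664, -603423104, 1410561792, 5244090368,
    -7881683968, -24540582912, 24594475008, 67120787456, -44855771136, -110472085504,
    47472082944, 107642748928, -26990346240, -57167052800, 6372720640, 12745441280]) chords"
  by (simp only: chords_def nonneg_on_eval)

section \<open>The case of n at least 20\<close>

definition tail :: "nat \<Rightarrow> real" where
  "tail n = sqrt (2 / (pi * (real n + 1 / 2)))"

text \<open>The coefficient of \<open>1 + cos\<close> in the second-order bound for even n; for odd
  n the coefficient is slightly smaller.\<close>

definition delta :: "nat \<Rightarrow> real \<Rightarrow> real" where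
  "delta n x = 1 / ((2 * real n + 4) * sin x)"

lemma tail_nonneg: "tail n \<ge> 0"
  by (simp add: tail_def)

lemma b_Suc_le_tail: "b (Suc n) \<le> tail n"
  unfolding tail_def by (rule b_Suc_le)

text \<open>Lagrange's identity gives the amplitude sqrt (p^2 + q^2), and this is at most p + q^2/2
  as soon as p >= 1.\<close>

lemma amplitude_le:
  fixes p q r s :: real
  assumes "r\<^sup>2 + s\<^sup>2 = 1" "p \<ge> 1"
  shows "- (p + q\<^sup>2 / 2) \<le> p * r + q * s"
proof -
  have "(p * r + q * s)\<^sup>2 \<le> (p * r + q * s)\<^sup>2 + (p * s - q * r)\<^sup>2" by simp
  also have "\<dots> = (p\<^sup>2 + q\<^sup>2) * (r\<^sup>2 + s\<^sup>2)"
    by (simp add: power2_eq_square algebra_simps)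
  also have "\<dots> = p\<^sup>2 + q\<^sup>2" using assms by simp
  also have "\<dots> \<le> (p + q\<^sup>2 / 2)\<^sup>2"
  proof -
    have "q\<^sup>2 * 1 \<le> q\<^sup>2 * p" using assms by (intro mult_left_mono) auto
    moreover have "0 \<le> (q\<^sup>2 / 2)\<^sup>2" by simp
    moreover have "(p + q\<^sup>2 / 2)\<^sup>2 = p\<^sup>2 + q\<^sup>2 * p + (q\<^sup>2 / 2)\<^sup>2"
      by (simp add: power2_sum algebra_simps)
    ultimately show ?thesis by linarith
  qed
  finally have "\<bar>p * r + q * s\<bar> \<le> p + q\<^sup>2 / 2"
    using assms by (intro abs_le_square_iff[THEN iffD2, THEN order_trans[OF _ eq_refl[OF
        abs_of_nonneg]]]) auto
  then show ?thesis by linarith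
qed

text \<open>The parity of \<open>n\<close> only enters through \<open>d\<close> and \<open>\<theta>\<close>.\<close>

lemma T_lower_second_order:
  assumes x: "0 < x" "x < pi" and n: "n > 0"
  obtains d \<theta> where "0 \<le> d" "d \<le> delta n x" "\<theta> = 0 \<or> \<theta> = x \<and> d * sin x = 1 / (2 * real n + 6)"
    "2 * sin (x / 2) * T n x \<ge> sqrt (sin x) + b (Suc n) *
      (sin ((real n + 1 / 2) * x) - (1 + cos ((real n + 1 / 2) * x + \<theta>)) * d)"
proof -
  have s: "sin x > 0" using x by (rule sin_gt_zero)
  show ?thesis
  proof (cases "even n")
    case True
    then obtain m where m: "n = 2 * m" by blast
    have e: "(4 * real m + 4) * sin x = (2 * real n + 4) * sin x" by (simp add: m)
    show ?thesis
      by (rule that[of "delta n x" 0])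
        (use T_even_lower_second_order[OF x, of m] n m b_Suc_double[of m] s in
          \<open>auto simp: delta_def e field_simps\<close>)
  next
    case False
    then obtain m where m: "n = Suc (2 * m)" by (metis oddE Suc_eq_plus1)
    have b: "b (Suc n) = cb (Suc m)" using b_double[of "Suc m"] m by simp
    define d where "d = 1 / ((2 * real n + 6) * sin x)"
    have e: "(4 * real m + 8) * sin x = (2 * real n + 6) * sin x"
        "(2 * real m + 3 / 2) * x = (real n + 1 / 2) * x"
      "(2 * real m + 5 / 2) * x = (real n + 1 / 2) * x + x"
      by (simp_all add: m algebra_simps)
    have ds: "d * sin x = 1 / (2 * real n + 6)" using s by (simp add: d_def)
    have dd: "d \<le> delta n x"
      unfolding d_def delta_def using s by (intro divide_left_mono mult_right_mono mult_pos_pos)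
          auto
    show ?thesis
    proof (rule that[of d x])
      show "2 * sin (x / 2) * T n x \<ge> sqrt (sin x) + b (Suc n) *
          (sin ((real n + 1 / 2) * x) - (1 + cos ((real n + 1 / 2) * x + x)) * d)"
        using T_odd_lower_second_order[OF x, of m] unfolding e b by (simp add: m[symmetric] d_def)
    qed (use s dd ds in \<open>auto simp: d_def\<close>)
  qed
qed

lemma T_lower_crude:
  assumes x: "0 < x" "x < pi" and n: "n > 0"
  shows "2 * sin (x / 2) * T n x
    \<ge> sqrt (sin x) - tail n * (1 + 1 / (2 * real n + 6) + delta n x + (delta n x)\<^sup>2 / 2)"
proof -
  define y where "y = (real n + 1 / 2) * x"
  define \<epsilon> where "\<epsilon> = 1 / (2 * real n + 6)"
  obtain d \<theta> where d: "0 \<le> d" "d \<le> delta n x" and \<theta>: "\<theta> = 0 \<or> \<theta> = x \<and> d * sin x = \<epsilon>"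
    and T: "2 * sin (x / 2) * T n x \<ge> sqrt (sin x) + b (Suc n) * (sin y - (1 + cos (y + \<theta>)) * d)"
    unfolding y_def \<epsilon>_def by (rule T_lower_second_order[OF x n])
  define E where "E = 1 + \<epsilon> + delta n x + (delta n x)\<^sup>2 / 2"
  have \<epsilon>: "\<epsilon> \<ge> 0" by (simp add: \<epsilon>_def)
  have d2: "d\<^sup>2 \<le> (delta n x)\<^sup>2" using d by (intro power_mono) auto
  have "- E \<le> sin y - (1 + cos (y + \<theta>)) * d"
    using \<theta>
  proof
    assume \<theta>: "\<theta> = 0"
    have "- (1 + d\<^sup>2 / 2) \<le> sin y - d * cos y"
      using amplitude_le[of "sin y" "cos y" 1 "- d"] by simp
    moreover have "(1 + cos (y + \<theta>)) * d = d + d * cos y"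
      using \<theta> by (simp add: algebra_simps)
    ultimately show ?thesis unfolding E_def using d d2 \<epsilon> by linarith
  next
    assume \<theta>: "\<theta> = x \<and> d * sin x = \<epsilon>"
    \<comment> \<open>Expanding cos (y + x) moves \<open>d * sin x = \<epsilon>\<close> into the
      coefficient of sin y. This is the origin of the term 1 / (2n + 6).\<close>
    have "- ((1 + \<epsilon>) + (- (d * cos x))\<^sup>2 / 2) \<le> (1 + \<epsilon>) * sin y + (- (d * cos x)) * cos y"
      by (rule amplitude_le) (use \<epsilon> in auto)
    moreover have "(1 + \<epsilon>) * sin y + (- (d * cos x)) * cos y = sin y - cos (y + x) * d"
      unfolding cos_add using \<theta> by (auto simp: algebra_simps)
    moreover have "(- (d * cos x))\<^sup>2 \<le> d\<^sup>2"
      by (simp add: power_mult_distrib mult_left_le abs_square_le_1)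
    moreover have "(1 + cos (y + \<theta>)) * d = d + cos (y + x) * d"
      using \<theta> by (simp add: algebra_simps)
    ultimately show ?thesis unfolding E_def using d d2 by linarith
  qed
  then have "b (Suc n) * - E \<le> b (Suc n) * (sin y - (1 + cos (y + \<theta>)) * d)"
    by (intro mult_left_mono b_nonneg)
  moreover have "b (Suc n) * E \<le> tail n * E"
    using \<epsilon> d by (intro mult_right_mono b_Suc_le_tail) (auto simp: E_def)
  ultimately have "sqrt (sin x) - tail n * E \<le> 2 * sin (x / 2) * T n x"
    using T by simp
  then show ?thesis by (simp add: E_def \<epsilon>_def)
qed

text \<open>In this phase range the sine is nonnegative and the shifted cosine nonpositive (its
  argument stays below 3 pi / 2), so only the constant part of the correction is lost.\<close>

lemma T_lower_half_wave:
  assumes x: "0 < x" "x < pi / 2" and n: "n > 0"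
    and y: "pi / 2 \<le> (real n + 1 / 2) * x" "(real n + 1 / 2) * x \<le> pi"
  shows "2 * sin (x / 2) * T n x \<ge> sqrt (sin x) - tail n * delta n x"
proof -
  define y where "y = (real n + 1 / 2) * x"
  have x': "x < pi" using x by simp
  obtain d \<theta> where d: "0 \<le> d" "d \<le> delta n x" and \<theta>: "\<theta> = 0 \<or> \<theta> = x"
    and T: "2 * sin (x / 2) * T n x \<ge> sqrt (sin x) + b (Suc n) * (sin y - (1 + cos (y + \<theta>)) * d)"
    unfolding y_def by (rule T_lower_second_order[OF x(1) x' n]) blast
  have "sin y \<ge> 0" using y x by (intro sin_ge_zero) (auto simp: y_def)
  moreover have "cos (y + \<theta>) \<le> 0"
  proof -
    have "sin (y + \<theta> - pi / 2) \<ge> 0"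
      using y x \<theta> by (intro sin_ge_zero) (auto simp: y_def)
    then show ?thesis by (simp add: sin_diff)
  qed
  then have "(1 + cos (y + \<theta>)) * d \<le> 1 * d"
    using d by (intro mult_right_mono) auto
  ultimately have "- delta n x \<le> sin y - (1 + cos (y + \<theta>)) * d" using d by linarith
  then have "b (Suc n) * - delta n x \<le> b (Suc n) * (sin y - (1 + cos (y + \<theta>)) * d)"
    by (intro mult_left_mono b_nonneg)
  moreover have "b (Suc n) * delta n x \<le> tail n * delta n x"
    using d by (intro mult_right_mono b_Suc_le_tail) auto
  ultimately show ?thesis using T by simp
qed

text \<open>Up to phase pi/2 every cosine added to \<open>T 1\<close> is nonnegative.\<close>

lemma T_ge_initial:
  assumes "0 \<le> x" "real n * x \<le> pi / 2" "n \<ge> 1"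
  shows "1 + cos x \<le> T n x"
  using assms(3,2)
proof (induction n rule: dec_induct)
  case base
  show ?case using b_double[of 0] b_Suc_double[of 0] by (simp add: T_def)
next
  case (step n)
  have "real n * x \<le> real (Suc n) * x" using assms(1) by (simp add: mult_right_mono)
  then have "1 + cos x \<le> T n x" using step by linarith
  moreover have "0 \<le> cos (real (Suc n) * x)"
    using step.prems assms(1) by (intro cos_ge_zero) (auto intro: order_trans[of _ 0])
  ultimately show ?case by (simp only: T_Suc) (smt (verit) b_nonneg mult_nonneg_nonneg)
qed

text \<open>Near pi the terms alternate, but a pair with equal coefficients contributes a positive
  multiple of sin ((2k + 1/2) u) sin (u/2), which is nonnegative up to phase pi.\<close>

lemma T_odd_ge_initial:
  assumes "0 \<le> u" "u \<le> pi" "(2 * real m + 1 / 2) * u \<le> pi"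
  shows "1 - cos u \<le> T (Suc (2 * m)) (pi - u)"
  using assms(3)
proof (induction m)
  case 0
  show ?case using b_double[of 0] b_Suc_double[of 0] by (simp add: T_def)
next
  case (Suc m)
  have "(2 * real m + 1 / 2) * u \<le> (2 * real (Suc m) + 1 / 2) * u"
    using assms(1) by (intro mult_right_mono) auto
  then have IH: "1 - cos u \<le> T (Suc (2 * m)) (pi - u)" using Suc by linarith
  define k where "k = 2 * Suc m"
  have k: "cos (real k * pi) = 1" "sin (real k * pi) = 0"
    "cos (real (Suc k) * pi) = -1" "sin (real (Suc k) * pi) = 0"
    unfolding cos_npi sin_npi by (simp_all add: k_def)
  have e: "real j * (pi - u) = real j * pi - real j * u" for j
    by (simp add: algebra_simps)
  have c: "cos (real k * (pi - u)) = cos (real k * u)"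
    "cos (real (Suc k) * (pi - u)) = - cos (real (Suc k) * u)"
    unfolding e cos_diff k by simp_all
  have "cos (real k * u) - cos (real (Suc k) * u) = 2 * sin ((2 * real (Suc m) + 1 / 2) * u) * sin
      (u / 2)"
    unfolding cos_diff_cos by (simp add: k_def algebra_simps add_divide_distrib)
  moreover have "sin ((2 * real (Suc m) + 1 / 2) * u) \<ge> 0"
    using Suc.prems assms by (intro sin_ge_zero) auto
  moreover have "sin (u / 2) \<ge> 0" using assms by (intro sin_ge_zero) auto
  ultimately have "cb (Suc m) * (cos (real k * u) - cos (real (Suc k) * u)) \<ge> 0"
    using cb_pos[of "Suc m"] by simp
  moreover have "T (Suc k) (pi - u) = T (Suc (2 * m)) (pi - u)
      + cb (Suc m) * (cos (real k * u) - cos (real (Suc k) * u))"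
    using T_Suc[of k "pi - u"] T_Suc[of "Suc (2 * m)" "pi - u"] b_double[of
        "Suc m"] b_Suc_double[of "Suc m"] c
    by (simp add: k_def algebra_simps)
  ultimately show ?case using IH by (simp add: k_def)
qed

text \<open>With y = (n + 1/2) x one has tail n = sqrt (2 / (pi y)) * sqrt x, so a lower bound on
  the phase y determines the factor \<open>K\<close>.\<close>

lemma tail_le_sqrt:
  assumes "0 < x" "2 \<le> K\<^sup>2 * ((15707963 / 5000000) * ((real n + 1 / 2) * x))" "K \<ge> 0"
  shows "tail n \<le> K * sqrt x"
proof -
  have "2 \<le> K\<^sup>2 * (pi * ((real n + 1 / 2) * x))"
    using assms(2) pi_bounds(1) assms(1)
    by (elim order_trans) (intro mult_left_mono mult_right_mono, auto)
  then have "2 / (pi * (real n + 1 / 2)) \<le> K\<^sup>2 * x"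
    by (subst pos_divide_le_eq) (auto simp: mult_ac intro!: mult_pos_pos add_nonneg_pos)
  then have "tail n \<le> sqrt (K\<^sup>2 * x)"
    unfolding tail_def by (rule real_sqrt_le_mono)
  also have "\<dots> = K * sqrt x" using assms by (simp add: real_sqrt_mult)
  finally show ?thesis .
qed

lemma sqrt_sin_lower:
  assumes "0 < x" "x \<le> (4 / 25)"
  shows "(4989 / 5000) * sqrt x \<le> sqrt (sin x)"
proof -
  have "x\<^sup>2 \<le> (4 / 25)\<^sup>2" using assms by (intro power_mono) auto
  then have "x * x\<^sup>2 \<le> x * (16 / 625)" using assms by (intro mult_left_mono) (auto simp:
      power2_eq_square)
  then have "(4989 / 5000)\<^sup>2 * x \<le> x - x ^ 3 / 6"
    using assms by (simp add: power2_eq_square power3_eq_cube)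
  also have "\<dots> \<le> sin x" using assms by (intro sin_lower_3) auto
  finally have "sqrt ((4989 / 5000)\<^sup>2 * x) \<le> sqrt (sin x)" by (rule real_sqrt_le_mono)
  then show ?thesis using assms by (simp add: real_sqrt_mult)
qed

lemma quadratic_small_x:
  assumes x: "0 < x" "x \<le> (4 / 25)"
  shows "(24582 / 100000) * sin (x / 2) * (pi - x)\<^sup>2 \<le> (2289 / 5000) * sqrt x"
proof -
  define r where "r = sqrt x"
  have "sqrt x \<le> sqrt ((2 / 5)\<^sup>2)"
    by (rule real_sqrt_le_mono) (use x in \<open>simp add: power2_eq_square\<close>)
  then have r: "0 \<le> r" "r \<le> 2 / 5" and xr: "x = r\<^sup>2"
    using x by (simp_all add: r_def)
  have r2: "r\<^sup>2 \<le> (4 / 25)" using x xr by simp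
  have "(pi - x)\<^sup>2 \<le> ((3927 / 1250) - x)\<^sup>2"
    using x pi_bounds by (intro power_mono) auto
  moreover have "sin (x / 2) \<le> x / 2" "sin (x / 2) \<ge> 0"
    using x pi_bounds sin_x_le_x[of "x / 2"] by (auto intro!: sin_ge_zero)
  ultimately have "sin (x / 2) * (pi - x)\<^sup>2 \<le> (x / 2) * ((3927 / 1250) - x)\<^sup>2"
    using x by (intro mult_mono) auto
  moreover have "r * ((3927 / 1250) - r\<^sup>2)\<^sup>2 \<le> (18 / 5)"
  proof -
    \<comment> \<open>With a = 3927/1250 > pi and f r = a^2 r - 2 a r^3, the product equals f (2/5)
      - f r. Thus the first two terms of the expanded polynomial are largest at 2/5, and r^5 is
      bounded separately.\<close>
    have "0 \<le> (2 / 5 - r) * ((3927 / 1250)\<^sup>2 - 2 * (3927 / 1250) * (4 / 25 + 2 / 5 * r + r\<^sup>2))"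
      using r r2 by (intro mult_nonneg_nonneg) (auto simp: power2_eq_square)
    moreover have "r ^ 5 \<le> (2 / 5) ^ 5" using r by (intro power_mono) auto
    moreover have "r * ((3927 / 1250) - r\<^sup>2)\<^sup>2 = (3927 / 1250)\<^sup>2 * r - 2 * (3927 / 1250) * r ^ 3 + r ^
        5"
      by (simp add: power2_eq_square eval_nat_numeral field_simps)
    moreover have "(2 / 5 - r) * ((3927 / 1250)\<^sup>2 - 2 * (3927 / 1250) * (4 / 25 + 2 / 5 * r + r\<^sup>2))
      = (3927 / 1250)\<^sup>2 * (2 / 5) - 2 * (3927 / 1250) * (8 / 125) - ((3927 / 1250)\<^sup>2 * r - 2 * (3927
          / 1250) * r ^ 3)"
      by (simp add: power2_eq_square eval_nat_numeral field_simps)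
    ultimately show ?thesis by (simp add: power_divide)
  qed
  then have "r * (r * ((3927 / 1250) - r\<^sup>2)\<^sup>2) \<le> r * (18 / 5)"
    using r by (intro mult_left_mono)
  moreover have "(x / 2) * ((3927 / 1250) - x)\<^sup>2 = r * (r * ((3927 / 1250) - r\<^sup>2)\<^sup>2) / 2"
    unfolding xr by (simp add: power2_eq_square)
  ultimately have "sin (x / 2) * (pi - x)\<^sup>2 \<le> r * (9 / 5)"
    by linarith
  then have "24582 / 100000 * (sin (x / 2) * (pi - x)\<^sup>2) \<le> 24582 / 100000 * (r * (9 / 5))"
    by (intro mult_left_mono) auto
  also have "\<dots> \<le> (2289 / 5000) * r" using r by simp
  finally show ?thesis by (simp only: r_def mult.assoc)
qed

lemma T_boundI:
  assumes "0 < x" "x < pi" and "24582 / 100000 * sin (x / 2) * (pi - x)\<^sup>2 \<le> 2 * sin (x / 2) * T n x"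
  shows "12291 / 100000 * (pi - x)\<^sup>2 \<le> T n x"
proof -
  have "sin (x / 2) > 0" using assms by (intro sin_gt_zero) auto
  moreover have "0 \<le> 2 * sin (x / 2) * (T n x - 12291 / 100000 * (pi - x)\<^sup>2)"
    using assms(3) by (simp add: algebra_simps)
  ultimately show ?thesis by (simp add: zero_le_mult_iff)
qed

text \<open>Three ranges of phase: up to n x = pi/2 already \<open>T 1\<close> suffices, since 1.9 >
  0.12291 pi^2; up to y = pi the half-wave bound applies; beyond that the crude bound does.\<close>

lemma T_large_left:
  assumes n: "n \<ge> 20" and x: "0 < x" "x \<le> (4 / 25)"
  shows "12291 / 100000 * (pi - x)\<^sup>2 \<le> T n x"
proof (cases "real n * x \<le> pi / 2")
  case True
  have "(pi - x)\<^sup>2 \<le> (3927 / 1250)\<^sup>2"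
    using x pi_bounds by (intro power_mono) auto
  moreover have "x\<^sup>2 \<le> (4 / 25)\<^sup>2" using x by (intro power_mono) auto
  then have "cos x \<ge> (9 / 10)" using cos_lower_2[of x] by (simp add: power2_eq_square)
  moreover have "1 + cos x \<le> T n x" using True n x by (intro T_ge_initial) auto
  ultimately show ?thesis by (simp add: power2_eq_square)
next
  case False
  have xpi: "x < pi" using x pi_bounds by linarith
  define y where "y = (real n + 1 / 2) * x"
  define \<delta> where "\<delta> = delta n x"
  have "(real n * x) \<le> y" using x by (simp add: y_def)
  then have y: "pi / 2 \<le> y" using False by linarith
  have "x\<^sup>2 \<le> (4 / 25)\<^sup>2" using x by (intro power_mono) auto
  then have "x * x\<^sup>2 \<le> x * (16 / 625)" using x by (intro mult_left_mono) (auto simp: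
      power2_eq_square)
  then have "(9957 / 10000) * x \<le> x - x ^ 3 / 6"
    using x by (simp add: power2_eq_square power3_eq_cube)
  then have sx: "(9957 / 10000) * x \<le> sin x" using sin_lower_3[of x] x by linarith
  have "2 * (9957 / 10000) * y \<le> (2 * real n + 4) * ((9957 / 10000) * x)"
    using x by (simp add: y_def algebra_simps)
  also have "\<dots> \<le> (2 * real n + 4) * sin x" using sx by (intro mult_left_mono) auto
  finally have dy: "2 * (9957 / 10000) * y \<le> (2 * real n + 4) * sin x" .
  have \<delta>: "\<delta> \<le> e" "\<delta> \<ge> 0" if "1 \<le> e * (2 * (9957 / 10000) * y)" "e > 0" for e
  proof -
    have "e * (2 * (9957 / 10000) * y) \<le> e * ((2 * real n + 4) * sin x)"
      using that(2) by (intro mult_left_mono dy) auto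
    then have "1 \<le> e * ((2 * real n + 4) * sin x)" using that(1) by linarith
    moreover have "0 < (2 * real n + 4) * sin x" using sx x by (intro mult_pos_pos) auto
    ultimately show "\<delta> \<le> e" "\<delta> \<ge> 0"
      by (auto simp: \<delta>_def delta_def pos_divide_le_eq)
  qed
  have r: "sqrt x \<ge> 0" using x by simp
  \<comment> \<open>The tail factors are 2/pi for y >= pi/2 and sqrt 2 / pi for y > pi, rounded up.
    Both 0.9978 - 0.6367 * 0.33 and 0.9978 - 0.4502 * 1.1946 exceed 0.4578.\<close>
  have "(2289 / 5000) * sqrt x \<le> 2 * sin (x / 2) * T n x"
  proof (cases "y \<le> pi")
    case True
    have t: "tail n \<le> (6367 / 10000) * sqrt x"
      by (rule tail_le_sqrt) (use y x pi_bounds in \<open>auto simp: y_def[symmetric] power2_eq_square\<close>)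
    have d: "\<delta> \<le> (33 / 100)" "\<delta> \<ge> 0" using \<delta>[of "(33 / 100)"] y pi_bounds by auto
    have "tail n * \<delta> \<le> ((6367 / 10000) * sqrt x) * (33 / 100)"
      using t d tail_nonneg r by (intro mult_mono) auto
    moreover have "2 * sin (x / 2) * T n x \<ge> sqrt (sin x) - tail n * \<delta>"
      unfolding \<delta>_def using n x y True pi_bounds by (intro T_lower_half_wave) (auto simp: y_def)
    ultimately show ?thesis using sqrt_sin_lower[OF x] r by linarith
  next
    case False
    have t: "tail n \<le> (2251 / 5000) * sqrt x"
      by (rule tail_le_sqrt) (use False x pi_bounds in \<open>auto simp: y_def[symmetric]
          power2_eq_square\<close>)
    have d: "\<delta> \<le> (4 / 25)" "\<delta> \<ge> 0" using \<delta>[of "(4 / 25)"] False pi_bounds by auto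
    have "\<delta>\<^sup>2 \<le> (4 / 25)\<^sup>2" using d by (intro power_mono) auto
    then have "\<delta>\<^sup>2 \<le> 16 / 625" by (simp add: power2_eq_square)
    moreover have "1 / (2 * real n + 6) \<le> 1 / 46" using n by (intro divide_left_mono) auto
    ultimately have "1 + 1 / (2 * real n + 6) + \<delta> + \<delta>\<^sup>2 / 2 \<le> (5973 / 5000)"
      using d by linarith
    then have "tail n * (1 + 1 / (2 * real n + 6) + \<delta> + \<delta>\<^sup>2 / 2)
        \<le> ((2251 / 5000) * sqrt x) * (5973 / 5000)"
      using t d tail_nonneg r by (intro mult_mono) auto
    moreover have "2 * sin (x / 2) * T n x
        \<ge> sqrt (sin x) - tail n * (1 + 1 / (2 * real n + 6) + \<delta> + \<delta>\<^sup>2 / 2)"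
      unfolding \<delta>_def using n x xpi by (intro T_lower_crude) auto
    ultimately show ?thesis using sqrt_sin_lower[OF x] r by linarith
  qed
  then show ?thesis
    using quadratic_small_x[OF x] x xpi by (intro T_boundI) auto
qed

section \<open>The middle range for large n\<close>

lemma tail_20:
  assumes "n \<ge> 20"
  shows "tail n \<le> (1763 / 10000)"
proof -
  have "tail n \<le> sqrt (2 / ((15707963 / 5000000) * (41 / 2)))"
    unfolding tail_def using assms pi_bounds
    by (intro real_sqrt_le_mono divide_left_mono mult_mono mult_pos_pos) (auto intro:
        add_nonneg_pos)
  also have "\<dots> \<le> (1763 / 10000)"
    by (rule real_le_lsqrt) (auto simp: power2_eq_square)
  finally show ?thesis .
qed

text \<open>Away from the endpoints the worst case is n = 20 at x = 4/25 from an end: the loss is at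
  most 0.1763 * 1.176 < 0.208.\<close>

lemma T_middle:
  assumes n: "n \<ge> 20" and x: "(4 / 25) \<le> x" "x \<le> pi - (4 / 25)"
  shows "2 * sin (x / 2) * T n x \<ge> sqrt (sin x) - (26 / 125)"
proof -
  have x': "0 < x" "x < pi" using x by auto
  define \<delta> where "\<delta> = delta n x"
  have "(1593 / 10000) \<le> sin ((4 / 25) :: real)"
    using sin_lower_3[of "(4 / 25)"] by (simp add: power3_eq_cube)
  also have "sin (4 / 25) \<le> sin x"
  proof (cases "x \<le> pi / 2")
    case True
    then show ?thesis using x pi_bounds by (intro sin_monotone_2pi_le) auto
  next
    case False
    then have "sin (4 / 25) \<le> sin (pi - x)" using x pi_bounds by (intro sin_monotone_2pi_le) auto
    then show ?thesis by simp
  qed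
  finally have A: "44 * (1593 / 10000) \<le> (2 * real n + 4) * sin x"
    using n by (intro mult_mono) auto
  have d0: "\<delta> \<ge> 0"
    unfolding \<delta>_def delta_def using A by (intro divide_nonneg_nonneg) auto
  have "\<delta> \<le> 1 / (44 * (1593 / 10000))"
    unfolding \<delta>_def delta_def by (rule frac_le) (use A in simp_all)
  then have d: "\<delta> \<le> (143 / 1000)" by simp
  have "\<delta>\<^sup>2 \<le> (143 / 1000)\<^sup>2" using d d0 by (intro power_mono) auto
  then have "\<delta>\<^sup>2 \<le> 20449 / 1000000" by (simp add: power2_eq_square)
  moreover have "1 / (2 * real n + 6) \<le> 1 / 46" using n by (intro divide_left_mono) auto
  ultimately have "1 + 1 / (2 * real n + 6) + \<delta> + \<delta>\<^sup>2 / 2 \<le> (147 / 125)"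
    using d by linarith
  then have "tail n * (1 + 1 / (2 * real n + 6) + \<delta> + \<delta>\<^sup>2 / 2) \<le> (1763 / 10000) * (147 / 125)"
    using tail_20[OF n] d0 tail_nonneg by (intro mult_mono) auto
  moreover have "2 * sin (x / 2) * T n x
      \<ge> sqrt (sin x) - tail n * (1 + 1 / (2 * real n + 6) + \<delta> + \<delta>\<^sup>2 / 2)"
    unfolding \<delta>_def using n x' by (intro T_lower_crude) auto
  ultimately show ?thesis by simp
qed

lemma T_large_middle_left:
  assumes n: "n \<ge> 20" and x: "(4 / 25) \<le> x" "x \<le> pi / 2"
  shows "12291 / 100000 * (pi - x)\<^sup>2 \<le> T n x"
proof -
  have x': "x < (79 / 50)" "0 < x" "x < pi" using x pi_bounds by auto
  \<comment> \<open>Certifies (0.208 + q x)^2 <= x - x^3/6 on [0.16, 1.58], where the cubic q is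
    0.123 x (3.142 - x)^2 with coefficients rounded up.\<close>
  have "nonneg_on 100 16 158 [-12979200, 148455360, -345899427, 497769082, -268827663, 57040020,
      -4538700]"
    by (simp only: nonneg_on_eval)
  then have "0 \<le> peval [-12979200, 148455360, -345899427, 497769082, -268827663, 57040020,
      -4538700] x"
    by (rule nonneg_onD) (use x x' in auto)
  also have "\<dots> = 300000000 * (x - x ^ 3 / 6) - 3 * (2080 + 12143 * x - 7729 * x\<^sup>2 + 1230 * x ^ 3)\<^sup>2"
    by (simp add: power2_eq_square power3_eq_cube algebra_simps)
  finally have "((2080 + 12143 * x - 7729 * x\<^sup>2 + 1230 * x ^ 3) / 10000)\<^sup>2 \<le> x - x ^ 3 / 6"
    by (simp add: power_divide)
  also have "\<dots> \<le> sin x" using x by (intro sin_lower_3) auto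
  finally have "(2080 + 12143 * x - 7729 * x\<^sup>2 + 1230 * x ^ 3) / 10000 \<le> sqrt (sin x)"
    by (rule real_le_rsqrt)
  moreover have "(24582 / 100000) * sin (x / 2) * (pi - x)\<^sup>2
      \<le> (123 / 1000) * x * ((1571 / 500) - x)\<^sup>2"
  proof -
    have "sin (x / 2) \<le> x / 2" "sin (x / 2) \<ge> 0"
      using x x' sin_x_le_x[of "x / 2"] by (auto intro!: sin_ge_zero)
    moreover have "(pi - x)\<^sup>2 \<le> ((1571 / 500) - x)\<^sup>2"
      using x x' pi_bounds by (intro power_mono) auto
    ultimately have "(24582 / 100000) * sin (x / 2) * (pi - x)\<^sup>2
        \<le> ((123 / 1000) * x) * ((1571 / 500) - x)\<^sup>2"
      using x' by (intro mult_mono[of "24582 / 100000 * sin (x / 2)"]) auto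
    then show ?thesis by simp
  qed
  moreover have "(123 / 1000) * x * ((1571 / 500) - x)\<^sup>2
      \<le> (12143 * x - 7729 * x\<^sup>2 + 1230 * x ^ 3) / 10000"
  proof -
    have "0 \<le> x * (24 + 32 * x)" using x by simp
    then show ?thesis using x' by (simp add: power2_eq_square power3_eq_cube algebra_simps)
  qed
  moreover have "2 * sin (x / 2) * T n x \<ge> sqrt (sin x) - (26 / 125)"
    using n x pi_bounds by (intro T_middle) auto
  ultimately have "(24582 / 100000) * sin (x / 2) * (pi - x)\<^sup>2 \<le> 2 * sin (x / 2) * T n x"
    by (simp add: add_divide_distrib diff_divide_distrib)
  then show ?thesis using x' by (intro T_boundI) auto
qed

lemma T_large_middle_right:
  assumes n: "n \<ge> 20" and x: "pi / 2 \<le> x" "x \<le> pi - (4 / 25)"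
  shows "12291 / 100000 * (pi - x)\<^sup>2 \<le> T n x"
proof -
  define u where "u = pi - x"
  have u: "(4 / 25) \<le> u" "u < (79 / 50)" using x pi_bounds by (auto simp: u_def)
  have x': "0 < x" "x < pi" "(4 / 25) \<le> x" using x pi_bounds by auto
  \<comment> \<open>Certifies (0.208 + 0.246 u^2)^2 <= u - u^3/6; here sin (x/2) is simply bounded
    by 1.\<close>
  have "nonneg_on 100 16 158 [-259584, 6000000, -614016, -1000000, -363096]"
    by (simp only: nonneg_on_eval)
  then have "0 \<le> peval [-259584, 6000000, -614016, -1000000, -363096] u"
    by (rule nonneg_onD) (use u in auto)
  also have "\<dots> = 6000000 * (u - u ^ 3 / 6) - 6 * (208 + 246 * u\<^sup>2)\<^sup>2"
    by (simp add: power2_eq_square power3_eq_cube algebra_simps)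
  finally have "((208 + 246 * u\<^sup>2) / 1000)\<^sup>2 \<le> u - u ^ 3 / 6"
    by (simp add: power_divide)
  also have "\<dots> \<le> sin u" using u by (intro sin_lower_3) auto
  finally have "(208 + 246 * u\<^sup>2) / 1000 \<le> sqrt (sin u)"
    by (rule real_le_rsqrt)
  moreover have "(24582 / 100000) * sin (x / 2) * (pi - x)\<^sup>2 \<le> (123 / 500) * u\<^sup>2"
    unfolding u_def using sin_le_one[of "x / 2"]
    by (intro mult_right_mono) (linarith, simp)
  moreover have "2 * sin (x / 2) * T n x \<ge> sqrt (sin x) - (26 / 125)"
    using n x x' by (intro T_middle) auto
  moreover have "sin u = sin x" by (simp add: u_def)
  ultimately have "(24582 / 100000) * sin (x / 2) * (pi - x)\<^sup>2 \<le> 2 * sin (x / 2) * T n x"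
    by (simp add: add_divide_distrib)
  then show ?thesis using x' by (intro T_boundI) auto
qed

text \<open>Used with v = (n + 1/2) u: multiplied by the squared tail it becomes 3 u / pi, free of n
  and below sin u for small u.\<close>

lemma one_minus_cos_square_le:
  fixes v :: real
  assumes "0 \<le> v"
  shows "(1 - cos v)\<^sup>2 \<le> 3 / 2 * v"
proof -
  \<comment> \<open>On a block [p, q] the left side is taken at q and the right side at p. Blocks
    are used only between 9/5, up to which the bound v^4/4 suffices, and 8/3, from which on the
    bound 4 does.\<close>
  have step: "(1 - cos v)\<^sup>2 \<le> 3 / 2 * v"
    if "p \<le> v" "v \<le> q" "0 \<le> p" "q \<le> 3" "(q ^ 2 / 2 - q ^ 4 / 24 + q ^ 6 / 720)\<^sup>2
        \<le> 3 / 2 * p" for p q :: real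
  proof -
    have "cos q \<le> cos v" using that pi_bounds by (intro cos_monotone_0_pi_le) auto
    then have "1 - cos v \<le> q ^ 2 / 2 - q ^ 4 / 24 + q ^ 6 / 720" using cos_lower_6[of q] by linarith
    then have "(1 - cos v)\<^sup>2 \<le> (q ^ 2 / 2 - q ^ 4 / 24 + q ^ 6 / 720)\<^sup>2"
      by (intro power_mono) auto
    then show ?thesis using that by linarith
  qed
  consider "v \<le> (9 / 5)" | "(9 / 5) \<le> v" "v \<le> (11 / 5)" | "(11 / 5) \<le> v" "v \<le> (12 / 5)" | "(12 / 5)
      \<le> v" "v \<le> (51 / 20)"
    | "(51 / 20) \<le> v" "v \<le> 8 / 3" | "8 / 3 \<le> v" by linarith
  then show ?thesis
  proof cases
    case 1
    have "v ^ 3 \<le> (9 / 5) ^ 3" using 1 assms by (intro power_mono) auto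
    then have "v * v ^ 3 \<le> v * 6" using assms by (intro mult_left_mono) (auto simp: power3_eq_cube)
    moreover have "(1 - cos v)\<^sup>2 \<le> (v\<^sup>2 / 2)\<^sup>2"
      using cos_lower_2[of v] by (intro power_mono) auto
    ultimately show ?thesis by (simp add: power2_eq_square power3_eq_cube)
  next
    case 6
    have "(1 - cos v)\<^sup>2 \<le> 2\<^sup>2"
      using cos_ge_minus_one[of v] by (intro power_mono) auto
    then show ?thesis using 6 by simp
  next
    case 2
    then show ?thesis by (rule step) (simp_all add: power_divide)
  next
    case 3
    then show ?thesis by (rule step) (simp_all add: power_divide)
  next
    case 4
    then show ?thesis by (rule step) (simp_all add: power_divide)
  next
    case 5
    then show ?thesis by (rule step) (simp_all add: power_divide)
  qed
qed

text \<open>With v = (n + 1/2) u the sine in the first-order bound is (-1)^n cos v. For even n the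
  loss 1 - cos v vanishes at v = 0; for odd n it is 1 + cos v, close to 2 at small phase, so that
  range is handled by pairing instead.\<close>

lemma T_large_right:
  assumes n: "n \<ge> 20" and u: "0 < u" "u \<le> (4 / 25)"
  shows "12291 / 100000 * u\<^sup>2 \<le> T n (pi - u)"
proof (cases "odd n \<and> (real n - 1 / 2) * u \<le> pi")
  case True
  then obtain m where m: "n = Suc (2 * m)" by (metis oddE Suc_eq_plus1)
  have "1 - cos u \<le> T n (pi - u)"
    unfolding m using True u pi_bounds by (intro T_odd_ge_initial) (auto simp: m algebra_simps)
  moreover have "12291 / 10 * u\<^sup>2 \<le> 3100 * (1 - cos u)"
    using u pi_bounds by (intro one_minus_cos_lower) auto
  moreover have "0 \<le> 1 - cos u" by simp
  ultimately show ?thesis by argo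
next
  case False
  define x where "x = pi - u"
  define v where "v = (real n + 1 / 2) * u"
  have x: "0 < x" "x < pi" using u pi_bounds by (auto simp: x_def)
  have arg: "(real n + 1 / 2) * x = real n * pi + (pi / 2 - v)"
    by (simp add: x_def v_def field_simps)
  have v: "v > 0" using u by (simp add: v_def)
  \<comment> \<open>0.9785 exceeds sqrt (3/pi) and also 2 * 0.4502, the odd case past phase pi. The
    remaining 0.9978 - 0.9785 = 0.0193 pays for 0.24582 u^2, since (sqrt u)^3 <= 0.064.\<close>
  have "tail n * (1 - sin ((real n + 1 / 2) * x)) \<le> (1957 / 2000) * sqrt u"
  proof (cases "even n")
    case True
    have "sin ((real n + 1 / 2) * x) = cos v"
      unfolding arg sin_add cos_npi sin_npi using True by (simp add: cos_sin_eq)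
    have "(tail n * (1 - cos v))\<^sup>2 = 2 / (pi * (real n + 1 / 2)) * (1 - cos v)\<^sup>2"
      by (simp add: tail_def power_mult_distrib)
    also have "\<dots> \<le> 2 / (pi * (real n + 1 / 2)) * (3 / 2 * v)"
      using one_minus_cos_square_le[of v] v by (intro mult_left_mono) auto
    also have "\<dots> = 3 * u / pi"
    proof -
      have "2 / (pi * k) * (3 / 2 * (k * u)) = 3 * u / pi" if "k > 0" for k
        using that by (simp add: field_simps)
      then show ?thesis by (simp add: v_def)
    qed
    also have "\<dots> \<le> (1957 / 2000)\<^sup>2 * u"
      using u pi_bounds by (simp add: pos_divide_le_eq power2_eq_square)
    finally have "tail n * (1 - cos v) \<le> sqrt ((1957 / 2000)\<^sup>2 * u)"
      by (rule real_le_rsqrt)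
    then show ?thesis
      using \<open>sin ((real n + 1 / 2) * x) = cos v\<close> by (simp add: real_sqrt_mult)
  next
    case odd: False
    then have "(real n - 1 / 2) * u > pi" using False by auto
    moreover have "(real n - 1 / 2) * u \<le> v" using u by (simp add: v_def)
    ultimately have "v > pi" by linarith
    then have "tail n \<le> (2251 / 5000) * sqrt u"
      using u pi_bounds by (intro tail_le_sqrt) (auto simp: v_def[symmetric] power2_eq_square)
    moreover have "tail n * (1 - sin ((real n + 1 / 2) * x)) \<le> tail n * 2"
      using sin_ge_minus_one[of "(real n + 1 / 2) * x"]
          by (intro mult_left_mono tail_nonneg) linarith
    moreover have "sqrt u \<ge> 0" using u by simp
    ultimately show ?thesis by linarith
  qed
  moreover have "2 * sin (x / 2) * T n x \<ge> sqrt (sin x) - b (Suc n) * (1 - sin ((real n + 1 / 2) *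
      x))"
    by (rule T_lower_first_order[OF x])
  moreover have "b (Suc n) * (1 - sin ((real n + 1 / 2) * x))
      \<le> tail n * (1 - sin ((real n + 1 / 2) * x))"
    by (intro mult_right_mono b_Suc_le_tail) auto
  moreover have "(4989 / 5000) * sqrt u \<le> sqrt (sin x)"
    using sqrt_sin_lower[OF u] by (simp add: x_def)
  moreover have "(24582 / 100000) * sin (x / 2) * (pi - x)\<^sup>2 \<le> (193 / 10000) * sqrt u"
  proof -
    have "sqrt u \<le> sqrt ((2 / 5)\<^sup>2)"
      by (rule real_sqrt_le_mono) (use u in \<open>simp add: power2_eq_square\<close>)
    then have r: "sqrt u \<le> (2 / 5)" "0 \<le> sqrt u" using u by simp_all
    have "(sqrt u) ^ 3 \<le> (2 / 5) ^ 3" using r by (intro power_mono) auto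
    then have "sqrt u * (sqrt u) ^ 3 \<le> sqrt u * (8 / 125)"
      using r by (intro mult_left_mono) (auto simp: power3_eq_cube)
    moreover have "sqrt u * (sqrt u) ^ 3 = u\<^sup>2"
      using u by (simp add: power2_eq_square power3_eq_cube)
    moreover have "(24582 / 100000) * sin (x / 2) * (pi - x)\<^sup>2 \<le> (24582 / 100000) * u\<^sup>2"
    proof -
      have "(pi - x)\<^sup>2 = u\<^sup>2" by (simp add: x_def)
      moreover have "24582 / 100000 * sin (x / 2) \<le> 24582 / 100000" by simp
      ultimately show ?thesis by (simp only:) (intro mult_right_mono, auto)
    qed
    ultimately show ?thesis using r by linarith
  qed
  ultimately have "(24582 / 100000) * sin (x / 2) * (pi - x)\<^sup>2 \<le> 2 * sin (x / 2) * T n x"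
    by linarith
  then have "12291 / 100000 * (pi - x)\<^sup>2 \<le> T n x"
    using x by (intro T_boundI) auto
  then show ?thesis by (simp add: x_def)
qed

lemma T_large:
  assumes "n \<ge> 20" "0 < x" "x < pi"
  shows "12291 / 100000 * (pi - x)\<^sup>2 \<le> T n x"
proof -
  consider "x \<le> (4 / 25)" | "(4 / 25) \<le> x" "x \<le> pi / 2" | "pi / 2 \<le> x" "x \<le> pi - (4 / 25)" |
      "pi - (4 / 25) \<le> x"
    by linarith
  then show ?thesis
  proof cases
    case 4
    then show ?thesis using T_large_right[of n "pi - x"] assms by simp
  qed (use assms T_large_left T_large_middle_left T_large_middle_right in auto)
qed

section \<open>The cases of n up to 19\<close>

lemma chords_bound:
  assumes s: "Tstate n p q t" and above: "list_all (above_chord t) cs" and maj: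
      "list_all majorizes cs"
    and c: "(l, h, u, v) \<in> set cs" "l < h" and x: "0 \<le> x" "x \<le> pi" "of_int l / 16 \<le> cos x"
        "cos x < of_int h / 16"
  shows "12291 / 100000 * (pi - x)\<^sup>2 \<le> T n x"
proof -
  have "above_chord t (l, h, u, v)" "majorizes (l, h, u, v)"
    using above maj c(1) by (auto simp: list_all_iff)
  then have "12291 / 10 * (pi - x)\<^sup>2 * (of_int h - of_int l) \<le> 10000 * (of_int h - of_int l) * T n x"
    using above_chordD[OF _ s x(3,4)] x unfolding majorizes_def prod.case by (meson order_trans)
  then have "0 \<le> (real_of_int h - of_int l) * (10000 * (T n x - 12291 / 100000 * (pi - x)\<^sup>2))"
    by (simp add: algebra_simps)
  then show ?thesis using c(2) by (simp add: zero_le_mult_iff)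
qed

lemma chords_cover:
  assumes "-1 \<le> c" "c < 1"
  shows "\<exists>(l, h, u, v) \<in> set chords. l < h \<and> of_int l / 16 \<le> c \<and> c < of_int h / (16 :: real)"
  using assms by (simp add: chords_def) argo

lemma chords_6_cover:
  assumes "-1 \<le> c" "c < 1" "c < 11 / 16 \<or> 12 / 16 \<le> c"
  shows "\<exists>(l, h, u, v) \<in> set chords_6. l < h \<and> of_int l / 16 \<le> c \<and> c < of_int h / (16 :: real)"
  using assms by (simp add: chords_6_def) argo

lemma chords_6_majorize: "list_all majorizes chords_6"
  using chords_majorize by (simp add: chords_def chords_6_def)

lemma above_chords:
  assumes "1 \<le> n" "n \<le> 19" "n \<noteq> 6"
  shows "\<exists>p q t. Tstate n p q t \<and> list_all (above_chord t) chords"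
proof -
  have "n = 1 \<or> n = 2 \<or> n = 3 \<or> n = 4 \<or> n = 5 \<or> n = 7 \<or> n = 8 \<or> n = 9 \<or> n = 10 \<or> n = 11 \<or> n = 12 \<or>
      n = 13 \<or> n = 14 \<or> n = 15 \<or> n = 16 \<or> n = 17 \<or> n = 18 \<or> n = 19"
    using assms by arith
  then show ?thesis
    by (elim disjE; hypsubst) (use Tstate_1 above_chords_1
      Tstate_2 above_chords_2
      Tstate_3 above_chords_3
      Tstate_4 above_chords_4
      Tstate_5 above_chords_5
      Tstate_7 above_chords_7
      Tstate_8 above_chords_8
      Tstate_9 above_chords_9
      Tstate_10 above_chords_10
      Tstate_11 above_chords_11
      Tstate_12 above_chords_12
      Tstate_13 above_chords_13
      Tstate_14 above_chords_14
      Tstate_15 above_chords_15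
      Tstate_16 above_chords_16
      Tstate_17 above_chords_17
      Tstate_18 above_chords_18
      Tstate_19 above_chords_19 in blast)+
qed

lemma cos_less_one:
  assumes "0 < x" "x < pi"
  shows "cos x < 1"
  using cos_monotone_0_pi[of 0 x] assms by simp

lemma T_small:
  assumes n: "1 \<le> n" "n \<le> 19" "n \<noteq> 6" and x: "0 < x" "x < pi"
  shows "12291 / 100000 * (pi - x)\<^sup>2 \<le> T n x"
proof -
  obtain p q t where "Tstate n p q t" "list_all (above_chord t) chords"
    using above_chords[OF n] by blast
  moreover obtain l h u v where "(l, h, u, v) \<in> set chords" "l < h"
      "of_int l / 16 \<le> cos x" "cos x < of_int h / 16"
    using chords_cover[of "cos x"] cos_less_one[OF x] by auto
  ultimately show ?thesis
    using x by (intro chords_bound[OF _ _ chords_majorize]) auto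
qed

lemma T_6_outside:
  assumes x: "0 < x" "x < pi" and c: "cos x < 11 / 16 \<or> 12 / 16 \<le> cos x"
  shows "12291 / 100000 * (pi - x)\<^sup>2 \<le> T 6 x"
proof -
  obtain l h u v where "(l, h, u, v) \<in> set chords_6" "l < h"
      "of_int l / 16 \<le> cos x" "cos x < of_int h / 16"
    using chords_6_cover[OF _ _ c] cos_less_one[OF x] by auto
  then show ?thesis
    using x by (intro chords_bound[OF Tstate_6 above_chords_6 chords_6_majorize]) auto
qed

section \<open>The minimum for n = 6\<close>

definition P6 :: "real \<Rightarrow> real" where
  "P6 c = 9 / 16 + 11 / 8 * c + 29 / 8 * c ^ 2 - 11 / 2 * c ^ 3 - 12 * c ^ 4 + 6 * c ^ 5 + 10 * c ^
      6"

definition P6' :: "real \<Rightarrow> real" where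
  "P6' c = 11 / 8 + 29 / 4 * c - 33 / 2 * c ^ 2 - 48 * c ^ 3 + 30 * c ^ 4 + 60 * c ^ 5"

definition P6'' :: "real \<Rightarrow> real" where
  "P6'' c = 29 / 4 - 33 * c - 144 * c ^ 2 + 120 * c ^ 3 + 300 * c ^ 4"

lemma T_6_eq: "T 6 x = P6 (cos x)"
proof -
  have "262144 * T 6 x = peval [147456, 360448, 950272, -1441792, -3145728, 1572864, 2621440] (cos
      x)"
    using Tstate_6 by (simp only: Tstate_def)
  also have "\<dots> = 262144 * P6 (cos x)"
    by (simp add: P6_def eval_nat_numeral field_simps)
  finally show ?thesis by simp
qed

text \<open>The rational 0.1229 stands in for alpha: it is the lower end of the claimed digits and
  leaves a small positive gap at the minimum.\<close>

definition \<phi> :: "real \<Rightarrow> real" where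
  "\<phi> x = T 6 x - 1229 / 10000 * (pi - x)\<^sup>2"

definition \<phi>' :: "real \<Rightarrow> real" where
  "\<phi>' x = 2458 / 10000 * (pi - x) - sin x * P6' (cos x)"

definition \<phi>'' :: "real \<Rightarrow> real" where
  "\<phi>'' x = P6'' (cos x) * (1 - (cos x)\<^sup>2) - cos x * P6' (cos x) - 2458 / 10000"

lemma P6_deriv: "(P6 has_real_derivative P6' c) (at c)"
  unfolding P6_def P6'_def by (auto intro!: derivative_eq_intros)

lemma P6'_deriv: "(P6' has_real_derivative P6'' c) (at c)"
  unfolding P6'_def P6''_def by (auto intro!: derivative_eq_intros)

lemma \<phi>_deriv: "(\<phi> has_real_derivative \<phi>' x) (at x)"
  unfolding \<phi>_def \<phi>'_def T_6_eq
  by (auto intro!: derivative_eq_intros DERIV_chain2[OF P6_deriv] simp: field_simps)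

lemma \<phi>'_deriv: "(\<phi>' has_real_derivative \<phi>'' x) (at x)"
proof -
  have "(\<phi>' has_real_derivative - (2458 / 10000) - (cos x * P6' (cos x) + P6'' (cos x) * - sin x *
      sin x)) (at x)"
    unfolding \<phi>'_def by (auto intro!: derivative_eq_intros DERIV_chain2[OF P6'_deriv] simp:
        field_simps)
  moreover have "- (2458 / 10000) - (cos x * P6' (cos x) + P6'' (cos x) * - sin x * sin x) = \<phi>'' x"
  proof -
    have "P6'' (cos x) * - sin x * sin x = - (P6'' (cos x) * (sin x)\<^sup>2)"
      by (simp add: power2_eq_square)
    then show ?thesis unfolding \<phi>''_def sin_squared_eq by simp
  qed
  ultimately show ?thesis by simp
qed

lemma cos_range:
  fixes x :: real
  assumes "7 / 10 \<le> x" "x \<le> 83 / 100"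
  shows "67 / 100 \<le> cos x" "cos x < 77 / 100"
proof -
  have "cos (83 / 100) \<le> cos x" "cos x \<le> cos (7 / 10)"
    using assms pi_bounds by (auto intro!: cos_monotone_0_pi_le)
  moreover have "67 / 100 \<le> cos (83 / 100 :: real)"
    using cos_lower_6[of "83 / 100"] by (simp add: power_divide)
  moreover have "cos (7 / 10 :: real) < 77 / 100"
    using cos_upper_4[of "7 / 10"] by (simp add: power_divide)
  ultimately show "67 / 100 \<le> cos x" "cos x < 77 / 100" by linarith+
qed

lemma \<phi>''_nonneg:
  assumes "7 / 10 \<le> x" "x \<le> 83 / 100"
  shows "0 \<le> \<phi>'' x"
proof -
  \<comment> \<open>The coefficients are those of 40000 times the second derivative as a polynomial
    in cos x.\<close>
  have "nonneg_on 100 67 77 [280168, -1375000, -6340000, 6780000, 19680000, -6000000, -14400000]"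
    by (simp only: nonneg_on_eval)
  then have "0 \<le> peval [280168, -1375000, -6340000, 6780000, 19680000, -6000000, -14400000] (cos x)"
    by (rule nonneg_onD) (use cos_range[OF assms] in auto)
  also have "\<dots> = 40000 * \<phi>'' x"
    by (simp add: \<phi>''_def P6'_def P6''_def eval_nat_numeral field_simps)
  finally show ?thesis by simp
qed

text \<open>\<open>t0\<close> is the minimum point of \<open>T 6 t / (t - \<pi>)\<^sup>2\<close> up to \<open>10^-5\<close>, so the tangent of the convex
  function \<open>\<phi>\<close> at \<open>t0\<close> is almost horizontal.\<close>

definition t0 :: real where
  "t0 = 72657 / 100000"

lemma cos_t0: "747457377 / 1000000000 \<le> cos t0" "cos t0 \<le> 747457400 / 1000000000"
  using cos_approx_10[of t0] unfolding t0_def abs_le_iff by (simp_all add: power_divide)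

lemma sin_t0: "664309458 / 1000000000 \<le> sin t0" "sin t0 \<le> 664309770 / 1000000000"
  using sin_approx_9[of t0] unfolding t0_def abs_le_iff by (simp_all add: power_divide)

text \<open>Separate enclosures of the powers make the later bounds on \<open>P6\<close> and
  \<open>P6'\<close> linear problems.\<close>

lemma cos_t0_powers:
  "558692530 / 1000000000 \<le> cos t0 ^ 2" "cos t0 ^ 2 \<le> 558692565 / 1000000000"
  "417598853 / 1000000000 \<le> cos t0 ^ 3" "cos t0 ^ 3 \<le> 417598892 / 1000000000"
  "312137343 / 1000000000 \<le> cos t0 ^ 4" "cos t0 ^ 4 \<le> 312137382 / 1000000000"
  "233309360 / 1000000000 \<le> cos t0 ^ 5" "cos t0 ^ 5 \<le> 233309396 / 1000000000"
  "174388802 / 1000000000 \<le> cos t0 ^ 6" "cos t0 ^ 6 \<le> 174388835 / 1000000000"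
proof -
  have lo: "(747457377 / 1000000000) ^ k \<le> cos t0 ^ k" for k
    by (intro power_mono cos_t0) simp
  have hi: "cos t0 ^ k \<le> (747457400 / 1000000000) ^ k" for k
    using cos_t0 by (intro power_mono) auto
  show "558692530 / 1000000000 \<le> cos t0 ^ 2" "417598853 / 1000000000 \<le> cos t0 ^ 3"
    "312137343 / 1000000000 \<le> cos t0 ^ 4" "233309360 / 1000000000 \<le> cos t0 ^ 5"
    "174388802 / 1000000000 \<le> cos t0 ^ 6"
    by (rule order_trans[OF _ lo]; simp add: power_divide)+
  show "cos t0 ^ 2 \<le> 558692565 / 1000000000" "cos t0 ^ 3 \<le> 417598892 / 1000000000"
    "cos t0 ^ 4 \<le> 312137382 / 1000000000" "cos t0 ^ 5 \<le> 233309396 / 1000000000"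
    "cos t0 ^ 6 \<le> 174388835 / 1000000000"
    by (rule order_trans[OF hi]; simp add: power_divide)+
qed

lemma T_6_t0: "716815 / 1000000 \<le> T 6 t0" "T 6 t0 \<le> 716819 / 1000000"
  unfolding T_6_eq P6_def using cos_t0 cos_t0_powers by linarith+

lemma pi_minus_t0: "24150226 / 10000000 \<le> pi - t0" "pi - t0 \<le> 24150227 / 10000000"
  using pi_bounds by (simp_all add: t0_def)

lemma pi_minus_t0_square: "(24150226 / 10000000)\<^sup>2 \<le> (pi - t0)\<^sup>2" "(pi - t0)\<^sup>2
    \<le> (24150227 / 10000000)\<^sup>2"
  using pi_minus_t0 by (auto intro!: power_mono)

lemma \<phi>_t0: "2 / 100000 \<le> \<phi> t0"
  unfolding \<phi>_def using T_6_t0 pi_minus_t0_square by (simp add: power_divide)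

lemma T_6_t0_less: "T 6 t0 < 12291 / 100000 * (pi - t0)\<^sup>2"
  using T_6_t0 pi_minus_t0_square by (simp add: power_divide)

lemma \<phi>'_t0: "\<bar>\<phi>' t0\<bar> \<le> 1 / 10000"
proof -
  have P: "893573 / 1000000 \<le> P6' (cos t0)" "P6' (cos t0) \<le> 893580 / 1000000"
    unfolding P6'_def using cos_t0 cos_t0_powers by linarith+
  have "sin t0 * P6' (cos t0) \<le> 664309770 / 1000000000 * (893580 / 1000000)"
    using P sin_t0 by (intro mult_mono) auto
  moreover have "664309458 / 1000000000 * (893573 / 1000000) \<le> sin t0 * P6' (cos t0)"
    using P sin_t0 by (intro mult_mono) auto
  ultimately show ?thesis
    unfolding \<phi>'_def abs_le_iff using pi_minus_t0 by argo
qed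

lemma T_6_inside:
  assumes x: "0 < x" "x < pi" and c: "11 / 16 \<le> cos x" "cos x < 12 / 16"
  shows "1229 / 10000 * (pi - x)\<^sup>2 \<le> T 6 x"
proof -
  have "7 / 10 \<le> x"
  proof (rule ccontr)
    assume "\<not> 7 / 10 \<le> x"
    then have "cos (7 / 10) \<le> cos x" using x pi_bounds by (intro cos_monotone_0_pi_le) auto
    moreover have "12 / 16 \<le> cos (7 / 10 :: real)"
      using cos_lower_6[of "7 / 10"] by (simp add: power_divide)
    ultimately show False using c by linarith
  qed
  moreover have "x \<le> 83 / 100"
  proof (rule ccontr)
    assume "\<not> x \<le> 83 / 100"
    then have "cos x \<le> cos (83 / 100)" using x pi_bounds by (intro cos_monotone_0_pi_le) auto
    moreover have "cos (83 / 100 :: real) < 11 / 16"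
      using cos_upper_4[of "83 / 100"] by (simp add: power_divide)
    ultimately show False using c by linarith
  qed
  ultimately have x': "x \<in> {7 / 10..83 / 100}" by simp
  have t0: "t0 \<in> {7 / 10..83 / 100}" by (simp add: t0_def)
  have "\<phi>' t0 * (x - t0) \<le> \<phi> x - \<phi> t0"
    by (rule f''_imp_f'[of "{7 / 10..83 / 100}" \<phi> \<phi>' \<phi>''])
      (use x' t0 \<phi>_deriv \<phi>'_deriv \<phi>''_nonneg in auto)
  \<comment> \<open>The tangent changes by at most 2 * 10^-5 on the interval, exactly the value
    guaranteed by \<open>\<phi>_t0\<close>.\<close>
  moreover have "\<bar>\<phi>' t0 * (x - t0)\<bar> \<le> 1 / 10000 * (2 / 10)"
  proof -
    have "\<bar>x - t0\<bar> \<le> 2 / 10" using x' unfolding t0_def abs_le_iff by simp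
    then show ?thesis unfolding abs_mult using \<phi>'_t0 by (intro mult_mono) auto
  qed
  ultimately have "0 \<le> \<phi> x" using \<phi>_t0 by linarith
  then show ?thesis by (simp add: \<phi>_def)
qed

lemma T_6_lower:
  assumes "0 \<le> x" "x < pi"
  shows "1229 / 10000 * (pi - x)\<^sup>2 \<le> T 6 x"
proof (cases "x = 0")
  case True
  have "pi\<^sup>2 \<le> 4\<^sup>2" using pi_bounds by (intro power_mono) auto
  then show ?thesis unfolding T_6_eq using True by (simp add: P6_def)
next
  case False
  then have x: "0 < x" "x < pi" using assms by auto
  have "0 \<le> (pi - x)\<^sup>2" by simp
  show ?thesis
  proof (cases "cos x < 11 / 16 \<or> 12 / 16 \<le> cos x")
    case True
    then show ?thesis using T_6_outside[OF x] \<open>0 \<le> (pi - x)\<^sup>2\<close> by argo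
  next
    case False
    then show ?thesis using T_6_inside[OF x] by auto
  qed
qed

lemma T_bound:
  assumes "n \<ge> 1" "n \<noteq> 6" "0 < x" "x < pi"
  shows "12291 / 100000 * (pi - x)\<^sup>2 \<le> T n x"
  using assms T_small[of n x] T_large[of n x] by (cases "n \<le> 19") auto

lemma T_6_minimum:
  obtains \<alpha> where "is_minimum_on (\<lambda>t. T 6 t / (t - pi)\<^sup>2) {0..<pi} \<alpha>"
    and "1229 / 10000 \<le> \<alpha>" "\<alpha> < 12291 / 100000"
    and "\<exists>t. 0 < t \<and> t < pi \<and> T 6 t = \<alpha> * (pi - t)\<^sup>2"
proof -
  define g where "g = (\<lambda>t. T 6 t / (t - pi)\<^sup>2)"
  have g: "c \<le> g t \<longleftrightarrow> c * (pi - t)\<^sup>2 \<le> T 6 t" "g t < c \<longleftrightarrow> T 6 t < c * (pi - t)\<^sup>2" if "t < pi" for c t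
  proof -
    have "(pi - t)\<^sup>2 > 0" using that by simp
    then show "c \<le> g t \<longleftrightarrow> c * (pi - t)\<^sup>2 \<le> T 6 t" "g t < c \<longleftrightarrow> T 6 t < c * (pi - t)\<^sup>2"
      unfolding g_def power2_commute[of t pi] by (simp_all add: pos_le_divide_eq pos_divide_less_eq)
  qed
  \<comment> \<open>The half-open domain is not compact. The minimum is taken over [0, pi/2]; beyond
    it cos t <= 0, and \<open>T_6_outside\<close> keeps \<open>g\<close> above its value at
    \<open>t0\<close>.\<close>
  have "continuous_on {0..pi / 2} g"
    unfolding g_def T_def by (intro continuous_intros) auto
  then obtain s where s: "s \<in> {0..pi / 2}" and min: "\<And>t. t \<in> {0..pi / 2} \<Longrightarrow> g s \<le> g t"
    using continuous_attains_inf[of "{0..pi / 2}" g] by auto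
  have s': "0 \<le> s" "s < pi" using s pi_gt_zero by (simp, simp only: atLeastAtMost_iff, linarith)
  have "g s \<le> g t0" using pi_bounds by (intro min) (auto simp: t0_def)
  also have "g t0 < 12291 / 100000"
    using T_6_t0_less pi_bounds by (subst g) (auto simp: t0_def)
  finally have upper: "g s < 12291 / 100000" .
  have lower: "1229 / 10000 \<le> g s" using T_6_lower[OF s'] g(1)[OF s'(2)] by simp
  have "g s \<le> g t" if t: "t \<in> {0..<pi}" for t
  proof (cases "t \<le> pi / 2")
    case True
    then show ?thesis using t by (intro min) auto
  next
    case False
    then have "cos t \<le> cos (pi / 2)" using t by (intro cos_monotone_0_pi_le) auto
    then have "12291 / 100000 * (pi - t)\<^sup>2 \<le> T 6 t"
      using t False by (intro T_6_outside) auto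
    then have "12291 / 100000 \<le> g t" using t g(1)[of t] by simp
    then show ?thesis using upper by linarith
  qed
  then have "is_minimum_on g {0..<pi} (g s)"
    using s' by (auto simp: is_minimum_on_def)
  \<comment> \<open>The theorem's inequalities hold on the open interval only, so the bound on
    \<open>c2\<close> requires a minimum point different from 0.\<close>
  moreover have "0 < s"
  proof (rule ccontr)
    assume "\<not> 0 < s"
    then have "s = 0" using s' by simp
    have "pi\<^sup>2 \<le> 4\<^sup>2" using pi_bounds by (intro power_mono) auto
    then have "12291 / 100000 * (pi - 0)\<^sup>2 \<le> T 6 0" unfolding T_6_eq by (simp add: P6_def)
    then have "12291 / 100000 \<le> g 0" unfolding g(1)[OF pi_gt_zero] .
    then show False using upper \<open>s = 0\<close> by simp
  qed
  moreover have "T 6 s = g s * (pi - s)\<^sup>2"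
    using s' by (simp add: g_def power2_commute)
  ultimately show ?thesis
    using that[of "g s"] upper lower s' unfolding g_def by blast
qed

section \<open>The characterisation\<close>

text \<open>In u = pi - x the quadratic is E - D u + c2 u^2 and lies between 0 and u^2/2. Letting u
  tend to 0 gives E = 0; dividing by u and letting u tend to 0 again gives D = 0.\<close>

lemma quadratic_below_T_1:
  fixes c0 c1 c2 :: real
  assumes q: "\<And>x. 0 < x \<Longrightarrow> x < pi \<Longrightarrow> 0 < c0 + c1 * x + c2 * x\<^sup>2 \<and> c0 + c1 * x + c2 * x\<^sup>2 \<le> 1 + cos x"
  shows "c1 = - 2 * pi * c2" "c0 = pi\<^sup>2 * c2"
proof -
  define D where "D = c1 + 2 * pi * c2"
  define E where "E = c0 + c1 * pi + c2 * pi\<^sup>2"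
  have e: "c0 + c1 * (pi - u) + c2 * (pi - u)\<^sup>2 = E - D * u + c2 * u\<^sup>2" for u
    by (simp add: D_def E_def power2_eq_square algebra_simps)
  have u: "0 < E - D * u + c2 * u\<^sup>2" "E - D * u + c2 * u\<^sup>2 \<le> u\<^sup>2 / 2" if "0 < u" "u < pi" for u
    using q[of "pi - u"] that cos_lower_2[of u] unfolding e by auto
  have ev: "\<forall>\<^sub>F u in at_right 0. 0 < u \<and> u < pi"
    using eventually_at_right_real[of 0 pi] by (auto elim: eventually_mono)
  have "((\<lambda>u. E - D * u + c2 * u\<^sup>2) \<longlongrightarrow> E - D * 0 + c2 * 0\<^sup>2) (at_right 0)"
    by (intro tendsto_intros)
  moreover have "((\<lambda>u. u\<^sup>2 / 2) \<longlongrightarrow> 0\<^sup>2 / 2) (at_right (0::real))"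
    by (intro tendsto_intros) auto
  moreover have "\<forall>\<^sub>F u in at_right 0. E - D * u + c2 * u\<^sup>2 \<le> u\<^sup>2 / 2" "\<forall>\<^sub>F u in at_right 0. 0
      \<le> E - D * u + c2 * u\<^sup>2"
    using ev by (eventually_elim, use u in \<open>auto intro: less_imp_le\<close>)+
  ultimately have E: "E = 0"
    using tendsto_le[of "at_right 0" "\<lambda>u. u\<^sup>2 / 2" "0\<^sup>2 / 2" "\<lambda>u. E - D * u + c2 * u\<^sup>2"
        "E - D * 0 + c2 * 0\<^sup>2"]
      tendsto_lowerbound[of "\<lambda>u. E - D * u + c2 * u\<^sup>2" "E - D * 0 + c2 * 0\<^sup>2" "at_right 0" 0]
    by (auto simp: trivial_limit_at_right_real)
  have u': "0 \<le> c2 * u - D" "c2 * u - D \<le> u / 2" if "0 < u" "u < pi" for u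
  proof -
    have "0 < u * (c2 * u - D)" "u * (c2 * u - D) \<le> u * (u / 2)"
      using u[OF that] E by (simp_all add: power2_eq_square algebra_simps)
    then show "0 \<le> c2 * u - D" "c2 * u - D \<le> u / 2"
      using that by (auto simp: zero_less_mult_iff)
  qed
  have "((\<lambda>u. c2 * u - D) \<longlongrightarrow> c2 * 0 - D) (at_right 0)"
    by (intro tendsto_intros)
  moreover have "((\<lambda>u. u / 2) \<longlongrightarrow> 0 / 2) (at_right (0::real))"
    by (intro tendsto_intros) auto
  moreover have "\<forall>\<^sub>F u in at_right 0. c2 * u - D \<le> u / 2" "\<forall>\<^sub>F u in at_right 0. 0 \<le> c2 * u - D"
    using ev by (eventually_elim, use u' in auto)+
  ultimately have D: "D = 0"
    using tendsto_le[of "at_right 0" "\<lambda>u. u / 2" "0 / 2" "\<lambda>u. c2 * u - D" "c2 * 0 - D"]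
      tendsto_lowerbound[of "\<lambda>u. c2 * u - D" "c2 * 0 - D" "at_right 0" 0]
    by (auto simp: trivial_limit_at_right_real)
  show c1: "c1 = - 2 * pi * c2" using D by (simp add: D_def)
  show "c0 = pi\<^sup>2 * c2" using E unfolding E_def c1 by (simp add: power2_eq_square)
qed

theorem mainTheorem1:
  shows "\<exists>\<alpha>::real.
    is_minimum_on (\<lambda>t. T 6 t / (t - pi)\<^sup>2) {0..<pi} \<alpha> \<and>
    0.12290 \<le> \<alpha> \<and> \<alpha> < 0.12291 \<and>
    (\<forall>c\<^sub>0 c\<^sub>1 c\<^sub>2 :: real.
      (\<forall>n::nat. n \<ge> 1 \<longrightarrow> (\<forall>x::real. x \<in> {0<..<pi} \<longrightarrow>
          T n x \<ge> c\<^sub>0 + c\<^sub>1 * x + c\<^sub>2 * x\<^sup>2 \<and> c\<^sub>0 + c\<^sub>1 * x + c\<^sub>2 * x\<^sup>2 > 0))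
      \<longleftrightarrow>
      (c\<^sub>0 = pi\<^sup>2 * c\<^sub>2 \<and> c\<^sub>1 = - 2 * pi * c\<^sub>2 \<and> 0 < c\<^sub>2 \<and> c\<^sub>2 \<le> \<alpha>))"
proof -
  obtain \<alpha> where min: "is_minimum_on (\<lambda>t. T 6 t / (t - pi)\<^sup>2) {0..<pi} \<alpha>"
    and a: "1229 / 10000 \<le> \<alpha>" "\<alpha> < 12291 / 100000"
    and attained: "\<exists>t. 0 < t \<and> t < pi \<and> T 6 t = \<alpha> * (pi - t)\<^sup>2"
    by (rule T_6_minimum)
  have T: "\<alpha> * (pi - x)\<^sup>2 \<le> T n x" if "n \<ge> 1" "0 < x" "x < pi" for n x
  proof (cases "n = 6")
    case True
    have "\<alpha> \<le> T 6 x / (x - pi)\<^sup>2" using min that by (auto simp: is_minimum_on_def)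
    then show ?thesis using that True by (simp add: pos_le_divide_eq power2_commute)
  next
    case False
    have "\<alpha> * (pi - x)\<^sup>2 \<le> 12291 / 100000 * (pi - x)\<^sup>2"
      using a by (intro mult_right_mono) auto
    then show ?thesis using T_bound[OF that(1) False that(2,3)] by linarith
  qed
  have square: "c0 + c1 * x + c2 * x\<^sup>2 = c2 * (pi - x)\<^sup>2"
    if "c0 = pi\<^sup>2 * c2" "c1 = - 2 * pi * c2" for c0 c1 c2 x
    unfolding that by (simp add: power2_eq_square algebra_simps)
  have T_1: "T 1 x = 1 + cos x" for x
    using b_double[of 0] b_Suc_double[of 0] by (simp add: T_def)
  have "(\<forall>n::nat. n \<ge> 1 \<longrightarrow> (\<forall>x::real. x \<in> {0<..<pi} \<longrightarrow>
          T n x \<ge> c0 + c1 * x + c2 * x\<^sup>2 \<and> c0 + c1 * x + c2 * x\<^sup>2 > 0))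
      \<longleftrightarrow> (c0 = pi\<^sup>2 * c2 \<and> c1 = - 2 * pi * c2 \<and> 0 < c2 \<and> c2 \<le> \<alpha>)" (is "?L \<longleftrightarrow> ?R") for c0 c1 c2
  proof
    assume L: ?L
    then have q: "0 < c0 + c1 * x + c2 * x\<^sup>2 \<and> c0 + c1 * x + c2 * x\<^sup>2 \<le> 1 + cos x" if "0 < x"
        "x < pi" for x
      using that unfolding T_1[symmetric] by auto
    have c: "c1 = - 2 * pi * c2" "c0 = pi\<^sup>2 * c2"
      using quadratic_below_T_1[OF q] by blast+
    \<comment> \<open>At the minimum point of the quotient the case n = 6 is sharp and yields the
      upper bound on \<open>c2\<close>.\<close>
    obtain t where t: "0 < t" "t < pi" "T 6 t = \<alpha> * (pi - t)\<^sup>2" using attained by blast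
    then have "0 < c2 * (pi - t)\<^sup>2" "c2 * (pi - t)\<^sup>2 \<le> \<alpha> * (pi - t)\<^sup>2"
      using L[rule_format, of 6 t] unfolding square[OF c(2,1)] by auto
    then show ?R using c t by (auto simp: zero_less_mult_iff)
  next
    assume R: ?R
    show ?L
    proof (intro allI impI)
      fix n :: nat and x :: real
      assume n: "n \<ge> 1" and "x \<in> {0<..<pi}"
      then have x: "0 < x" "x < pi" by auto
      have "c2 * (pi - x)\<^sup>2 \<le> \<alpha> * (pi - x)\<^sup>2" using R by (intro mult_right_mono) auto
      moreover have "0 < c2 * (pi - x)\<^sup>2" using R x by simp
      ultimately show "T n x \<ge> c0 + c1 * x + c2 * x\<^sup>2 \<and> c0 + c1 * x + c2 * x\<^sup>2 > 0"
        using T[OF n x] R square[of c0 c2 c1 x] by auto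
    qed
  qed
  then show ?thesis
    using min a by (intro exI[of _ \<alpha>]) simp
qed

end
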